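(* Let $d \in \mathbb{N}$ and consider the $*$-probability space $(\mathbb{C}[S_\infty], \varphi_d)$. Let $r \in \mathbb{N}$ and let $$\underline{\gamma} : \{1,\ldots,r\} \times \mathbb{N} \to \{\gamma_n \mid n \in \mathbb{N}\} \subseteq \mathbb{C}[S_\infty]$$ be an injective function, where $\{\gamma_n \mid n \in \mathbb{N}\}$ are the star-generators of $S_\infty$. For every $p \in \{1,\ldots,r\}$ and $n \in \mathbb{N}$ consider the selfadjoint element $$s_{p,n} := \frac{1}{\sqrt{n}} \Bigl( \underline{\gamma}(p,1) + \cdots + \underline{\gamma}(p,n) - \frac{n}{d} \Bigr) \in \mathbb{C}[S_\infty],$$ and for every $n \in \mathbb{N}$ let $\mu_n \in \mathcal{D}_r$ be the joint distribution of the $r$-tuple $s_{1,n}, \ldots, s_{r,n}$. Then: (1) The sequence $(\mu_n)_{n=1}^\infty$ converges in moments to a limit $\mu^{(r,d)} \in \mathcal{D}_r$. (2) Let $f$ be the commuting exponential generating function for the moments of $\mu^{(r,d)}$, and let $g$ be the commuting exponential generating function for the moments of the joint GUE distribution $\nu^{(r,d)}$. Then $$f(z_1,\ldots,z_r) \cdot e^{(z_1^2 + \cdots + z_r^2)/(2d^2)} = g(z_1,\ldots,z_r).$$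
   Context: $\mathbb{N} = \{1,2,\ldots\}$. $S_\infty$ is the group of bijections $\tau : \mathbb{N} \to \mathbb{N}$ for which there is $k_o$ with $\tau(k) = k$ for all $k > k_o$. For $\tau \in S_\infty$, $\|\tau\|$ is the minimal number $m$ of transpositions in a factorization $\tau = \rho_1 \cdots \rho_m$ (with $\|\tau\| = 0$ iff $\tau$ is the identity). $\varphi_d : \mathbb{C}[S_\infty] \to \mathbb{C}$ is the linear functional determined by $\varphi_d(\tau) = (1/d)^{\|\tau\|}$ for $\tau \in S_\infty$. The group algebra has the $*$-operation determined by $\tau^* = \tau^{-1}$; $\varphi_d$ is positive. A $*$-probability space is a unital $*$-algebra over $\mathbb{C}$ with a positive linear functional taking $1$ to $1$. The star-generators are $\gamma_n = (1,n+1)$, $n\in\mathbb{N}$; a scalar in $\mathbb{C}[S_\infty]$ means that multiple of the unit. $\mathbb{C}\langle X_1,\ldots,X_r\rangle$ is the algebra of polynomials in non-commuting indeterminates, with the $*$-operation determined by $X_p^* = X_p$. $\mathcal{D}_r$ is the set of linear functionals $\mu : \mathbb{C}\langle X_1,\ldots,X_r\rangle \to \mathbb{C}$ with $\mu(1)=1$ that are positive ($\mu(P^*P)\ge 0$ for all $P$). Convergence in moments $\mu_n \to \mu$ means $\lim_n \mu_n(P) = \mu(P)$ for all $P \in \mathbb{C}\langle X_1,\ldots,X_r\rangle$. The joint distribution of selfadjoint elements $a_1,\ldots,a_r$ of a $*$-probability space $(\mathcal{A},\varphi)$ is the functional $\mu \in \mathcal{D}_r$ with $\mu(X_{i(1)}\cdots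 X_{i(k)}) = \varphi(a_{i(1)}\cdots a_{i(k)})$ for all $k\in\mathbb{N}$ and $(i(1),\ldots,i(k)) \in \{1,\ldots,r\}^k$. The commuting exponential generating function for the moments of $\mu$ is the power series in commuting indeterminates $z_1,\ldots,z_r$ $$1 + \sum_{k=1}^\infty \sum_{i(1),\ldots,i(k)=1}^r \frac{\mu(X_{i(1)}\cdots X_{i(k)})}{k!} z_{i(1)}\cdots z_{i(k)}.$$ $\nu^{(r,d)} \in \mathcal{D}_r$ is defined by $\nu^{(r,d)}(X_{i(1)}\cdots X_{i(k)}) = E(\mathrm{tr}_d(M_{i(1)}\cdots M_{i(k)}))$, where $\mathrm{tr}_d$ is the normalized trace on $d\times d$ matrices, $E$ is the expectation, and $M_1,\ldots,M_r$ are $d\times d$ GUE random matrices of variance $1$ with independent entries: $M_n$ is selfadjoint, with $(i,i)$-entry $\xi_{i,i}^{(n)}$, and for $i<j$ with $(i,j)$-entry $\xi_{i,j}^{(n)} + \sqrt{-1}\,\eta_{i,j}^{(n)}$ and $(j,i)$-entry $\xi_{i,j}^{(n)} - \sqrt{-1}\,\eta_{i,j}^{(n)}$, where all the $\xi_{i,j}^{(n)}$ ($i\le j$) and $\eta_{i,j}^{(n)}$ ($i<j$), over all $n$, are independent centered real Gaussian random variables with $\mathrm{Var}(\xi_{i,i}^{(n)}) = 1/d$ and $\mathrm{Var}(\xi_{i,j}^{(n)}) = \mathrm{Var}(\eta_{i,j}^{(n)}) = 1/(2d)$ for $i<j$. *)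

theory Defs
  imports
    "HOL-Probability.Probability"
    "HOL-Library.Poly_Mapping"
    "HOL-Library.Multiset"
    "HOL-Combinatorics.Transposition"
    "Jordan_Normal_Form.Matrix"
begin

section \<open>Monoid \<open>*\<close>-algebras over the complex numbers\<close>

text \<open>
  The convolution ring \<^typ>\<open>'m \<Rightarrow>\<^sub>0 complex\<close> of the library is the complex monoid algebra of a
  (not necessarily commutative) monoid \<open>'m\<close> that is written additively.  Consequently the monoids
  used below, the infinite symmetric group and the free monoid, carry additive notation:
  \<open>+\<close> is composition of permutations respectively concatenation of words.
\<close>

class involutive_monoid = monoid_add +
  fixes adj :: "'a \<Rightarrow> 'a"
  assumes adj_adj: "adj (adj a) = a"
    and adj_add: "adj (a + b) = adj b + adj a"

definition star :: "('m::involutive_monoid \<Rightarrow>\<^sub>0 complex) \<Rightarrow> ('m \<Rightarrow>\<^sub>0 complex)" where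
  "star P = (\<Sum>m\<in>Poly_Mapping.keys P.
     Poly_Mapping.single (adj m) (cnj (Poly_Mapping.lookup P m)))"

definition scalar :: "complex \<Rightarrow> ('m::monoid_add \<Rightarrow>\<^sub>0 complex)" where
  "scalar c = Poly_Mapping.single 0 c"

definition lin_ext :: "('m \<Rightarrow> complex) \<Rightarrow> ('m \<Rightarrow>\<^sub>0 complex) \<Rightarrow> complex" where
  "lin_ext h P = (\<Sum>m\<in>Poly_Mapping.keys P. Poly_Mapping.lookup P m * h m)"

definition states :: "(('m::involutive_monoid \<Rightarrow>\<^sub>0 complex) \<Rightarrow> complex) set" where
  "states = {\<mu>. (\<forall>P Q. \<mu> (P + Q) = \<mu> P + \<mu> Q) \<and> (\<forall>c P. \<mu> (scalar c * P) = c * \<mu> P) \<and>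
                \<mu> 1 = 1 \<and> (\<forall>P. \<mu> (star P * P) \<in> \<real>\<^sub>\<ge>\<^sub>0)}"

lemma lin_ext_superset:
  "finite A \<Longrightarrow> Poly_Mapping.keys P \<subseteq> A \<Longrightarrow> lin_ext h P = (\<Sum>m\<in>A. Poly_Mapping.lookup P m * h m)"
  unfolding lin_ext_def by (rule sum.mono_neutral_left) (auto simp: in_keys_iff)

lemma lin_ext_add: "lin_ext h (P + Q) = lin_ext h P + lin_ext h Q"
proof -
  let ?A = "Poly_Mapping.keys P \<union> Poly_Mapping.keys Q"
  have "Poly_Mapping.keys (P + Q) \<subseteq> ?A" by (rule Poly_Mapping.keys_add)
  then show ?thesis
    by (simp add: lin_ext_superset[of ?A] lookup_add distrib_right sum.distrib)
qed

lemma lin_ext_single: "lin_ext h (Poly_Mapping.single m c) = c * h m"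
  by (simp add: lin_ext_def)

lemma lookup_scalar_times: "Poly_Mapping.lookup (scalar c * P) m = c * Poly_Mapping.lookup P m"
  unfolding scalar_def by (simp add: lookup_mult lookup_single when_mult mult_when)

lemma lin_ext_scalar: "lin_ext h (scalar c * P) = c * lin_ext h P"
proof -
  have "Poly_Mapping.keys (scalar c * P) \<subseteq> Poly_Mapping.keys P"
    by (auto simp: in_keys_iff lookup_scalar_times)
  then show ?thesis
    by (simp add: lin_ext_superset[of "Poly_Mapping.keys P"] lookup_scalar_times sum_distrib_left
        mult.assoc)
qed

lemma star_superset:
  "finite A \<Longrightarrow> Poly_Mapping.keys P \<subseteq> A \<Longrightarrow>
   star P = (\<Sum>m\<in>A. Poly_Mapping.single (adj m) (cnj (Poly_Mapping.lookup P m)))"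
  unfolding star_def by (rule sum.mono_neutral_left) (auto simp: in_keys_iff)

lemma star_add: "star (P + Q) = star P + star Q"
proof -
  let ?A = "Poly_Mapping.keys P \<union> Poly_Mapping.keys Q"
  have "Poly_Mapping.keys (P + Q) \<subseteq> ?A" by (rule Poly_Mapping.keys_add)
  then show ?thesis
    by (simp add: star_superset[of ?A] lookup_add single_add sum.distrib)
qed

lemma star_single: "star (Poly_Mapping.single m c) = Poly_Mapping.single (adj m) (cnj c)"
  by (simp add: star_def)


section \<open>The group algebra of the infinite symmetric group\<close>

text \<open>
  Permutations of \<open>{1, 2, \<dots>}\<close> are represented by permutations of \<^typ>\<open>nat\<close> that fix \<open>0\<close>.
\<close>

typedef sinf = "{\<tau> :: nat \<Rightarrow> nat. bij \<tau> \<and> \<tau> 0 = 0 \<and> (\<exists>k\<^sub>0. \<forall>k>k\<^sub>0. \<tau> k = k)}"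
  morphisms sinf_apply Abs_sinf
  by (rule exI[of _ id]) auto

setup_lifting type_definition_sinf

instantiation sinf :: group_add
begin

lift_definition zero_sinf :: sinf is id by auto

lift_definition plus_sinf :: "sinf \<Rightarrow> sinf \<Rightarrow> sinf" is "(\<circ>)"
proof -
  fix f g :: "nat \<Rightarrow> nat"
  assume f: "bij f \<and> f 0 = 0 \<and> (\<exists>k\<^sub>0. \<forall>k>k\<^sub>0. f k = k)"
    and g: "bij g \<and> g 0 = 0 \<and> (\<exists>k\<^sub>0. \<forall>k>k\<^sub>0. g k = k)"
  from f g obtain a b where "\<forall>k>a. f k = k" "\<forall>k>b. g k = k" by blast
  then have "\<forall>k>max a b. (f \<circ> g) k = k" by auto
  then have "\<exists>k\<^sub>0. \<forall>k>k\<^sub>0. (f \<circ> g) k = k" by blast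
  moreover have "bij (f \<circ> g)" using f g by (auto intro: bij_comp)
  ultimately show "bij (f \<circ> g) \<and> (f \<circ> g) 0 = 0 \<and> (\<exists>k\<^sub>0. \<forall>k>k\<^sub>0. (f \<circ> g) k = k)"
    using f g by auto
qed

lift_definition uminus_sinf :: "sinf \<Rightarrow> sinf" is "inv_into UNIV"
  by (metis bij_imp_bij_inv bij_inv_eq_iff)

definition minus_sinf :: "sinf \<Rightarrow> sinf \<Rightarrow> sinf" where
  "minus_sinf a b = a + (- b)"

instance
proof
  fix a b c :: sinf
  show "a + b + c = a + (b + c)" by transfer auto
  show "0 + a = a" by transfer auto
  show "a + 0 = a" by transfer auto
  show "- a + a = 0" by transfer (auto simp: bij_is_inj)
  show "a + - b = a - b" by (simp add: minus_sinf_def)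
qed

end

instantiation sinf :: involutive_monoid
begin
definition adj_sinf :: "sinf \<Rightarrow> sinf" where "adj_sinf \<tau> = - \<tau>"
instance by standard (simp_all add: adj_sinf_def minus_add)
end

definition is_transposition :: "sinf \<Rightarrow> bool" where
  "is_transposition \<rho> \<longleftrightarrow>
     (\<exists>a b. 1 \<le> a \<and> 1 \<le> b \<and> a \<noteq> b \<and> sinf_apply \<rho> = Transposition.transpose a b)"

definition sinf_length :: "sinf \<Rightarrow> nat" where
  "sinf_length \<tau> = (LEAST m. \<exists>\<rho>s. length \<rho>s = m \<and> (\<forall>\<rho>\<in>set \<rho>s. is_transposition \<rho>) \<and>
                             \<tau> = sum_list \<rho>s)"

definition phi :: "nat \<Rightarrow> (sinf \<Rightarrow>\<^sub>0 complex) \<Rightarrow> complex" where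
  "phi d = lin_ext (\<lambda>\<tau>. (1 / of_nat d) ^ sinf_length \<tau>)"

lift_definition star_transposition :: "nat \<Rightarrow> sinf" is "\<lambda>n. Transposition.transpose 1 (n + 1)"
  by (auto simp: Transposition.transpose_def intro!: exI[of _ "Suc _"])

definition star_generator :: "nat \<Rightarrow> (sinf \<Rightarrow>\<^sub>0 complex)" where
  "star_generator n = Poly_Mapping.single (star_transposition n) 1"

lemma star_star_generator: "star (star_generator n) = star_generator n"
proof -
  have "- star_transposition n = star_transposition n"
    by transfer (simp only: inv_transpose_eq)
  then show ?thesis by (simp add: star_generator_def star_single adj_sinf_def)
qed


section \<open>Non-commutative polynomials and joint distributions\<close>

datatype 'r nc_word = NC_Word (letters: "'r list")

instantiation nc_word :: (type) involutive_monoid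
begin
definition zero_nc_word :: "'a nc_word" where "zero_nc_word = NC_Word []"
definition plus_nc_word :: "'a nc_word \<Rightarrow> 'a nc_word \<Rightarrow> 'a nc_word" where
  "plus_nc_word v w = NC_Word (letters v @ letters w)"
definition adj_nc_word :: "'a nc_word \<Rightarrow> 'a nc_word" where
  "adj_nc_word w = NC_Word (rev (letters w))"
instance
  by standard (simp_all add: zero_nc_word_def plus_nc_word_def adj_nc_word_def)
end

text \<open>
  The \<open>r\<close> indeterminates are indexed by a finite type \<open>'r\<close> with \<open>r\<close> elements.  The algebra of
  polynomials in non-commuting indeterminates is \<^typ>\<open>'r nc_word \<Rightarrow>\<^sub>0 complex\<close>, and the set of its
  positive unital functionals is \<^term>\<open>states :: (('r nc_word \<Rightarrow>\<^sub>0 complex) \<Rightarrow> complex) set\<close>.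
\<close>

definition nc_monom :: "'r list \<Rightarrow> ('r nc_word \<Rightarrow>\<^sub>0 complex)" where
  "nc_monom w = Poly_Mapping.single (NC_Word w) 1"

definition joint_distribution ::
    "('a::monoid_mult \<Rightarrow> complex) \<Rightarrow> ('r \<Rightarrow> 'a) \<Rightarrow> ('r nc_word \<Rightarrow>\<^sub>0 complex) \<Rightarrow> complex" where
  "joint_distribution \<phi> a = lin_ext (\<lambda>w. \<phi> (prod_list (map a (letters w))))"

lemma joint_distribution_nc_monom:
  "joint_distribution \<phi> a (nc_monom w) = \<phi> (prod_list (map a w))"
  by (simp add: joint_distribution_def nc_monom_def lin_ext_single)


section \<open>Formal power series in commuting indeterminates\<close>

text \<open>
  The monomial \<open>z\<^bsub>i(1)\<^esub> \<cdots> z\<^bsub>i(k)\<^esub>\<close> corresponds to the multiset \<open>{#i(1), \<dots>, i(k)#}\<close>, and a power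
  series is the family of its coefficients.
\<close>

typedef 'r mfps = "UNIV :: ('r multiset \<Rightarrow> complex) set"
  morphisms mfps_coeff Abs_mfps ..

setup_lifting type_definition_mfps

lemma finite_subset_mset: "finite {A. A \<subseteq># M}"
proof (rule finite_subset)
  show "{A. A \<subseteq># M} \<subseteq> mset ` {xs. set xs \<subseteq> set_mset M \<and> length xs \<le> size M}"
  proof
    fix A assume "A \<in> {A. A \<subseteq># M}"
    then have A: "A \<subseteq># M" by simp
    obtain xs where "mset xs = A" using ex_mset by blast
    with A have "set xs \<subseteq> set_mset M \<and> length xs \<le> size M"
      by (metis set_mset_mono set_mset_mset size_mset size_mset_mono)
    with \<open>mset xs = A\<close> show "A \<in> mset ` {xs. set xs \<subseteq> set_mset M \<and> length xs \<le> size M}"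
      by blast
  qed
  show "finite (mset ` {xs. set xs \<subseteq> set_mset M \<and> length xs \<le> size M})"
    by (intro finite_imageI finite_lists_length_le) simp
qed

instantiation mfps :: (type) comm_ring_1
begin

lift_definition zero_mfps :: "'a mfps" is "\<lambda>_. 0" .
lift_definition one_mfps :: "'a mfps" is "\<lambda>M. if M = {#} then 1 else 0" .
lift_definition plus_mfps :: "'a mfps \<Rightarrow> 'a mfps \<Rightarrow> 'a mfps" is "\<lambda>f g M. f M + g M" .
lift_definition minus_mfps :: "'a mfps \<Rightarrow> 'a mfps \<Rightarrow> 'a mfps" is "\<lambda>f g M. f M - g M" .
lift_definition uminus_mfps :: "'a mfps \<Rightarrow> 'a mfps" is "\<lambda>f M. - f M" .
lift_definition times_mfps :: "'a mfps \<Rightarrow> 'a mfps \<Rightarrow> 'a mfps"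
  is "\<lambda>f g M. \<Sum>A | A \<subseteq># M. f A * g (M - A)" .

instance
proof
  fix a b c :: "'a mfps"
  show "a + b + c = a + (b + c)" by transfer (simp add: add.assoc)
  show "a + b = b + a" by transfer (simp add: add.commute)
  show "0 + a = a" by transfer simp
  show "- a + a = 0" by transfer simp
  show "a - b = a + - b" by transfer simp
  show "(a + b) * c = a * c + b * c" by transfer (simp add: distrib_right sum.distrib)
  show "(0 :: 'a mfps) \<noteq> 1" by transfer (auto dest: fun_cong[of _ _ "{#}"])
  show "a * b = b * a"
  proof (transfer, rule ext)
    fix a b :: "'a multiset \<Rightarrow> complex" and M
    show "(\<Sum>A | A \<subseteq># M. a A * b (M - A)) = (\<Sum>A | A \<subseteq># M. b A * a (M - A))"
    proof (rule sum.reindex_bij_witness[of _ "\<lambda>A. M - A" "\<lambda>A. M - A"])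
      fix A assume "A \<in> {A. A \<subseteq># M}"
      then show "M - (M - A) = A" by (simp add: multiset_eq_iff subseteq_mset_def)
      then show "b (M - A) * a (M - (M - A)) = a A * b (M - A)" by (simp add: mult.commute)
    qed (auto simp: multiset_eq_iff subseteq_mset_def)
  qed
  show "1 * a = a"
  proof (transfer, rule ext)
    fix a :: "'a multiset \<Rightarrow> complex" and M
    have "(\<Sum>A | A \<subseteq># M. (if A = {#} then 1 else 0) * a (M - A))
        = (\<Sum>A\<in>{{#}}. (if A = {#} then 1 else 0) * a (M - A))"
      by (rule sum.mono_neutral_right) (auto simp: finite_subset_mset)
    then show "(\<Sum>A | A \<subseteq># M. (if A = {#} then 1 else 0) * a (M - A)) = a M" by simp
  qed
  show "a * b * c = a * (b * c)"
  proof (transfer, rule ext)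
    fix a b c :: "'a multiset \<Rightarrow> complex" and M
    have "(\<Sum>A | A \<subseteq># M. (\<Sum>B | B \<subseteq># A. a B * b (A - B)) * c (M - A))
        = (\<Sum>(A, B)\<in>(SIGMA A:{A. A \<subseteq># M}. {B. B \<subseteq># A}). a B * b (A - B) * c (M - A))"
      by (simp add: sum_distrib_right sum.Sigma finite_subset_mset)
    also have "\<dots> = (\<Sum>(B, D)\<in>(SIGMA B:{B. B \<subseteq># M}. {D. D \<subseteq># M - B}).
                      a B * (b D * c (M - B - D)))"
      by (rule sum.reindex_bij_witness[of _ "\<lambda>(B, D). (B + D, B)" "\<lambda>(A, B). (B, A - B)"])
        (auto simp: multiset_eq_iff subseteq_mset_def mult.assoc diff_diff_add
          diff_le_mono le_diff_conv2 add.commute intro: order_trans)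
    also have "\<dots> = (\<Sum>B | B \<subseteq># M. a B * (\<Sum>D | D \<subseteq># M - B. b D * c (M - B - D)))"
      by (simp add: sum_distrib_left sum.Sigma finite_subset_mset)
    finally show "(\<Sum>A | A \<subseteq># M. (\<Sum>B | B \<subseteq># A. a B * b (A - B)) * c (M - A))
        = (\<Sum>B | B \<subseteq># M. a B * (\<Sum>D | D \<subseteq># M - B. b D * c (M - B - D)))" .
  qed
qed

end

definition mfps_const :: "complex \<Rightarrow> 'r mfps" where
  "mfps_const c = Abs_mfps (\<lambda>M. if M = {#} then c else 0)"

definition mfps_var :: "'r \<Rightarrow> 'r mfps" where
  "mfps_var p = Abs_mfps (\<lambda>M. if M = {#p#} then 1 else 0)"

text \<open>
  If \<open>h\<close> has no constant term then only the finitely many \<open>k \<le> size M\<close> contribute to the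
  coefficient of \<open>M\<close> in the exponential of \<open>h\<close>.
\<close>

definition mfps_exp :: "'r mfps \<Rightarrow> 'r mfps" where
  "mfps_exp h = Abs_mfps (\<lambda>M. suminf (\<lambda>k. mfps_coeff (h ^ k) M / fact k))"

text \<open>
  The commuting exponential generating function: the coefficient of a monomial collects the
  contributions of all tuples \<open>i(1), \<dots>, i(k)\<close> that are rearrangements of it.  The empty tuple
  contributes the constant term \<open>\<mu>(1)\<close>, which is \<open>1\<close> for unital \<open>\<mu>\<close>.
\<close>

definition comm_egf :: "(('r nc_word \<Rightarrow>\<^sub>0 complex) \<Rightarrow> complex) \<Rightarrow> 'r mfps" where
  "comm_egf \<mu> = Abs_mfps (\<lambda>M. \<Sum>w | mset w = M. \<mu> (nc_monom w) / fact (length w))"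


section \<open>Joint distribution of independent GUE random matrices\<close>

text \<open>
  Matrix indices run over \<open>0, \<dots>, d - 1\<close>.  All the variables \<open>\<xi> p i j\<close> (\<open>i \<le> j\<close>) and
  \<open>\<eta> p i j\<close> (\<open>i < j\<close>) together form one independent family, indexed by a disjoint sum.
\<close>

definition gue_entries ::
    "nat \<Rightarrow> 'w measure \<Rightarrow> ('r \<Rightarrow> nat \<Rightarrow> nat \<Rightarrow> 'w \<Rightarrow> real) \<Rightarrow> ('r \<Rightarrow> nat \<Rightarrow> nat \<Rightarrow> 'w \<Rightarrow> real) \<Rightarrow> bool"
  where
  "gue_entries d \<Omega> \<xi> \<eta> \<longleftrightarrow>
     prob_space \<Omega> \<and>
     prob_space.indep_vars \<Omega> (\<lambda>_. borel)
       (case_sum (\<lambda>(p, i, j). \<xi> p i j) (\<lambda>(p, i, j). \<eta> p i j))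
       ({(p, i, j). i \<le> j \<and> j < d} <+> {(p, i, j). i < j \<and> j < d}) \<and>
     (\<forall>p. \<forall>i<d. distributed \<Omega> lborel (\<xi> p i i) (normal_density 0 (sqrt (1 / real d)))) \<and>
     (\<forall>p. \<forall>j<d. \<forall>i<j.
        distributed \<Omega> lborel (\<xi> p i j) (normal_density 0 (sqrt (1 / (2 * real d)))) \<and>
        distributed \<Omega> lborel (\<eta> p i j) (normal_density 0 (sqrt (1 / (2 * real d)))))"

definition gue_matrix ::
    "nat \<Rightarrow> (nat \<Rightarrow> nat \<Rightarrow> 'w \<Rightarrow> real) \<Rightarrow> (nat \<Rightarrow> nat \<Rightarrow> 'w \<Rightarrow> real) \<Rightarrow> 'w \<Rightarrow> complex Matrix.mat"
  where
  "gue_matrix d \<xi> \<eta> \<omega> = Matrix.mat d d (\<lambda>(i, j).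
     if i = j then complex_of_real (\<xi> i i \<omega>)
     else if i < j then complex_of_real (\<xi> i j \<omega>) + \<i> * complex_of_real (\<eta> i j \<omega>)
     else complex_of_real (\<xi> j i \<omega>) - \<i> * complex_of_real (\<eta> j i \<omega>))"

definition normalized_trace :: "complex Matrix.mat \<Rightarrow> complex" where
  "normalized_trace A = (\<Sum>i<dim_row A. A $$ (i, i)) / of_nat (dim_row A)"

definition gue_distribution ::
    "nat \<Rightarrow> 'w measure \<Rightarrow> ('r \<Rightarrow> nat \<Rightarrow> nat \<Rightarrow> 'w \<Rightarrow> real) \<Rightarrow> ('r \<Rightarrow> nat \<Rightarrow> nat \<Rightarrow> 'w \<Rightarrow> real) \<Rightarrow>
     ('r nc_word \<Rightarrow>\<^sub>0 complex) \<Rightarrow> complex" where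
  "gue_distribution d \<Omega> \<xi> \<eta> = lin_ext (\<lambda>w.
     (\<integral>\<omega>. normalized_trace
            (foldr (*) (map (\<lambda>p. gue_matrix d (\<xi> p) (\<eta> p) \<omega>) (letters w)) (1\<^sub>m d)) \<partial>\<Omega>))"

end

theory Submission
  imports Defs "HOL-Real_Asymp.Real_Asymp"
begin

text \<open>
  The number of colourings of a finite set \<open>S\<close> by \<open>d\<close> colours that are fixed by \<open>\<tau>\<close> is \<open>d\<close> to the power
  \<open>card S - \<parallel>\<tau>\<parallel>\<close>, so \<^term>\<open>phi d\<close> is the normalized trace of the permutation action on a tensor power
  of the \<open>d\<close>-dimensional space.  There the star-generator at site \<open>u\<close> is the sum over \<open>a, b < d\<close> of
  \<open>e\<^sub>a\<^sub>b\<close> at site \<open>1\<close> times \<open>e\<^sub>b\<^sub>a\<close> at site \<open>u\<close>; hence a word in the \<open>s\<^sub>p\<^sub>,\<^sub>n\<close> has as its moment a sum over closed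
  paths of colours of joint moments of normalized sums of commuting independent copies of the centred matrix units.
  By the central limit theorem these become Gaussian with covariance
  \<open>(\<delta>\<^sub>a\<^sub>b\<^sub>' \<delta>\<^sub>a\<^sub>'\<^sub>b - \<delta>\<^sub>a\<^sub>b \<delta>\<^sub>a\<^sub>'\<^sub>b\<^sub>' / d) / d\<close>, that is, the limit is the traceless GUE.  A GUE matrix is the sum
  of its traceless part and an independent scalar Gaussian of variance \<open>1/d\<^sup>2\<close>, which accounts for the
  exponential factor.
\<close>

section \<open>Functions on words under the dual of the shuffle product\<close>

text \<open>Matrix units at one site do not commute, so the moments attached to a site depend on the
  order of the letters; only different sites commute. This is why the bookkeeping uses functions on
  words rather than on multisets: such a function records the moments of a noncommuting family, and
  independent commuting families are combined by a commutative product. Removing the first letter is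
  a derivation of this product, and a function is determined by its value at the empty word and its
  derivatives. Hence the exponential, which describes the Gaussian limit, is recognised by a
  differential equation; the central limit theorem, Wick's formula and the splitting of the
  covariance all take place in one ring. Collecting words by content is a ring homomorphism to
  commuting power series (\<open>wegf_mult\<close>), so an identity between exponentials of
  covariances carries over to the generating functions. The other obstacle is that the length of a
  permutation is a minimum over factorizations; counting colourings settles it, with two colours for
  the lower bound and \<open>d\<close> colours for the trace.\<close>

text \<open>
  \<open>wconv F G w\<close> sums \<open>F u * G v\<close> over all ways of splitting \<open>w\<close> into complementary subwords \<open>u\<close> and \<open>v\<close>.
  It expresses how mixed moments of sums of independent commuting families arise.
\<close>

primrec wconv :: "('a list \<Rightarrow> complex) \<Rightarrow> ('a list \<Rightarrow> complex) \<Rightarrow> 'a list \<Rightarrow> complex" where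
  "wconv F G [] = F [] * G []"
| "wconv F G (x # w) = wconv (\<lambda>u. F (x # u)) G w + wconv F (\<lambda>u. G (x # u)) w"

lemma wconv_commute: "wconv F G w = wconv G F w"
  by (induction w arbitrary: F G) (simp_all add: add.commute)

lemma wconv_add_left: "wconv (\<lambda>w. F w + F' w) G w = wconv F G w + wconv F' G w"
  by (induction w arbitrary: F F' G) (simp_all add: distrib_right)

lemma wconv_scale_left: "wconv (\<lambda>w. c * F w) G w = c * wconv F G w"
  by (induction w arbitrary: F G) (simp_all add: distrib_left)

lemma wconv_zero_left: "wconv (\<lambda>w. 0) G w = 0"
  using wconv_scale_left[of 0 "\<lambda>w. 0" G w] by simp

lemma wconv_add_right: "wconv F (\<lambda>w. G w + G' w) w = wconv F G w + wconv F G' w"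
  by (subst (1 2 3) wconv_commute) (rule wconv_add_left)

lemma wconv_assoc: "wconv (wconv F G) H w = wconv F (wconv G H) w"
  by (induction w arbitrary: F G H)
    (simp_all add: wconv_add_left wconv_add_right mult.assoc add.assoc)

lemma wconv_unit_left: "wconv (\<lambda>w. if w = [] then 1 else 0) G w = G w"
  by (induction w arbitrary: G) (simp_all add: wconv_zero_left)

section \<open>The commutative ring of word functions and its derivations\<close>

typedef 'a wfun = "UNIV :: ('a list \<Rightarrow> complex) set"
  morphisms wcoeff Abs_wfun ..

setup_lifting type_definition_wfun

lemma wcoeff_Abs [simp]: "wcoeff (Abs_wfun F) = F"
  by (simp add: Abs_wfun_inverse)

lemma wfun_eqI: "(\<And>w. wcoeff F w = wcoeff G w) \<Longrightarrow> F = G"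
  by transfer auto

instantiation wfun :: (type) comm_ring_1
begin

lift_definition zero_wfun :: "'a wfun" is "\<lambda>_. 0" .
lift_definition one_wfun :: "'a wfun" is "\<lambda>w. if w = [] then 1 else 0" .
lift_definition plus_wfun :: "'a wfun \<Rightarrow> 'a wfun \<Rightarrow> 'a wfun" is "\<lambda>F G w. F w + G w" .
lift_definition minus_wfun :: "'a wfun \<Rightarrow> 'a wfun \<Rightarrow> 'a wfun" is "\<lambda>F G w. F w - G w" .
lift_definition uminus_wfun :: "'a wfun \<Rightarrow> 'a wfun" is "\<lambda>F w. - F w" .
lift_definition times_wfun :: "'a wfun \<Rightarrow> 'a wfun \<Rightarrow> 'a wfun" is wconv .

instance
proof
  fix a b c :: "'a wfun"
  show "a + b + c = a + (b + c)" by transfer (simp add: add.assoc)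
  show "a + b = b + a" by transfer (simp add: add.commute)
  show "0 + a = a" by transfer simp
  show "- a + a = 0" by transfer simp
  show "a - b = a + - b" by transfer simp
  show "(a + b) * c = a * c + b * c" by transfer (simp add: wconv_add_left fun_eq_iff)
  show "(0 :: 'a wfun) \<noteq> 1" by transfer (auto dest: fun_cong[of _ _ "[]"])
  show "a * b = b * a" by transfer (simp add: wconv_commute fun_eq_iff)
  show "1 * a = a" by transfer (simp add: wconv_unit_left fun_eq_iff)
  show "a * b * c = a * (b * c)" by transfer (simp add: wconv_assoc fun_eq_iff)
qed

end

lift_definition wconst :: "complex \<Rightarrow> 'a wfun" is "\<lambda>c w. if w = [] then c else 0" .

lift_definition wderiv :: "'a \<Rightarrow> 'a wfun \<Rightarrow> 'a wfun" is "\<lambda>x F w. F (x # w)" .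

lemma wcoeff_zero [simp]: "wcoeff 0 w = 0" by transfer simp
lemma wcoeff_one: "wcoeff 1 w = (if w = [] then 1 else 0)" by transfer simp
lemma wcoeff_add [simp]: "wcoeff (F + G) w = wcoeff F w + wcoeff G w" by transfer simp
lemma wcoeff_diff [simp]: "wcoeff (F - G) w = wcoeff F w - wcoeff G w" by transfer simp
lemma wcoeff_sum: "wcoeff (\<Sum>i\<in>A. F i) w = (\<Sum>i\<in>A. wcoeff (F i) w)"
  by (induction A rule: infinite_finite_induct) auto
lemma wcoeff_wderiv [simp]: "wcoeff (wderiv x F) w = wcoeff F (x # w)" by transfer simp
lemma wcoeff_mult_Nil [simp]: "wcoeff (F * G) [] = wcoeff F [] * wcoeff G []" by transfer simp
lemma wcoeff_mult_Cons:
  "wcoeff (F * G) (x # w) = wcoeff (wderiv x F * G) w + wcoeff (F * wderiv x G) w"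
  by transfer simp

lemma wcoeff_prod_Nil: "wcoeff (\<Prod>i\<in>A. F i) [] = (\<Prod>i\<in>A. wcoeff (F i) [])"
  by (induction A rule: infinite_finite_induct) (auto simp: wcoeff_one)

lemma wcoeff_power_Nil: "wcoeff (F ^ n) [] = wcoeff F [] ^ n"
  by (induction n) (auto simp: wcoeff_one)

lemma wcoeff_wconst_mult [simp]: "wcoeff (wconst c * F) w = c * wcoeff F w"
proof (transfer)
  fix c and F :: "'a list \<Rightarrow> complex" and w
  show "wconv (\<lambda>w. if w = [] then c else 0) F w = c * F w"
    using wconv_scale_left[of c "\<lambda>w. if w = [] then 1 else 0" F w]
    by (simp add: wconv_unit_left if_distrib[of "(*) c"] cong: if_cong)
qed

lemma wderiv_simps [simp]:
  "wderiv x (1 :: 'a wfun) = 0" "wderiv x (0 :: 'a wfun) = 0"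
  "wderiv x (F + G) = wderiv x F + wderiv x G"
  "wderiv x (F - G) = wderiv x F - wderiv x G"
  by (rule wfun_eqI; simp add: wcoeff_one)+

lemma wderiv_wconst_mult: "wderiv x (wconst c * F) = wconst c * wderiv x F"
  by (rule wfun_eqI) simp

text \<open>The first letter of a word goes to one of the two complementary subwords, which makes
  its removal a derivation.\<close>

lemma wderiv_mult: "wderiv x (F * G) = wderiv x F * G + F * wderiv x G"
  by (rule wfun_eqI) (simp add: wcoeff_mult_Cons)

lemma wderiv_prod:
  assumes "finite A"
  shows "wderiv x (\<Prod>i\<in>A. F i) = (\<Sum>i\<in>A. wderiv x (F i) * (\<Prod>j\<in>A - {i}. F j))"
  using assms
proof (induction A)
  case (insert a A)
  have "(\<Sum>i\<in>A. wderiv x (F i) * (\<Prod>j\<in>insert a A - {i}. F j))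
      = (\<Sum>i\<in>A. F a * (wderiv x (F i) * (\<Prod>j\<in>A - {i}. F j)))"
  proof (rule sum.cong)
    fix i assume "i \<in> A"
    then have "insert a A - {i} = insert a (A - {i})" using insert.hyps by auto
    then show "wderiv x (F i) * (\<Prod>j\<in>insert a A - {i}. F j)
        = F a * (wderiv x (F i) * (\<Prod>j\<in>A - {i}. F j))"
      using insert.hyps by (simp add: mult_ac)
  qed simp
  moreover have "insert a A - {a} = A" using insert.hyps by auto
  ultimately show ?case
    using insert by (simp add: wderiv_mult sum_distrib_left)
qed simp

lemma wderiv_power: "wderiv x (F ^ n) = of_nat n * wderiv x F * F ^ (n - 1)"
proof (induction n)
  case (Suc n)
  show ?case
  proof (cases n)
    case 0
    then show ?thesis by simp
  next
    case (Suc m)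
    then show ?thesis using Suc.IH by (simp add: wderiv_mult algebra_simps)
  qed
qed simp

lemma of_nat_wconst: "(of_nat n :: 'a wfun) = wconst (of_nat n)"
proof (induction n)
  case 0
  show ?case by (rule wfun_eqI) (simp add: wconst.rep_eq)
next
  case (Suc n)
  then show ?case by (intro wfun_eqI) (simp add: wconst.rep_eq wcoeff_one)
qed

lemma wcoeff_of_nat_mult [simp]: "wcoeff (of_nat n * F) w = of_nat n * wcoeff F w"
  by (simp add: of_nat_wconst)

text \<open>A coefficient of a product at \<open>w\<close> involves only subwords of
  \<open>w\<close>; this is what allows truncated series and induction on length.\<close>

lemma wcoeff_mult_cong:
  assumes "\<And>u. length u \<le> length w \<Longrightarrow> wcoeff F u = wcoeff F' u"
    and "\<And>u. length u \<le> length w \<Longrightarrow> wcoeff G u = wcoeff G' u"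
  shows "wcoeff (F * G) w = wcoeff (F' * G') w"
  using assms
proof (induction w arbitrary: F G F' G')
  case (Cons x w)
  have "wcoeff (wderiv x F * G) w = wcoeff (wderiv x F' * G') w"
    by (rule Cons.IH) (auto intro: Cons.prems)
  moreover have "wcoeff (F * wderiv x G) w = wcoeff (F' * wderiv x G') w"
    by (rule Cons.IH) (auto intro: Cons.prems)
  ultimately show ?case by (simp add: wcoeff_mult_Cons)
qed simp

lemma tendsto_wcoeff_mult:
  assumes "\<And>u. length u \<le> length w \<Longrightarrow> ((\<lambda>n. wcoeff (F n) u) \<longlongrightarrow> wcoeff F' u) X"
    and "\<And>u. length u \<le> length w \<Longrightarrow> ((\<lambda>n. wcoeff (G n) u) \<longlongrightarrow> wcoeff G' u) X"
  shows "((\<lambda>n. wcoeff (F n * G n) w) \<longlongrightarrow> wcoeff (F' * G') w) X"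
  using assms
proof (induction w arbitrary: F G F' G')
  case Nil
  then show ?case by (auto intro!: tendsto_mult)
next
  case (Cons x w)
  have "((\<lambda>n. wcoeff (wderiv x (F n) * G n) w) \<longlongrightarrow> wcoeff (wderiv x F' * G') w) X"
    by (rule Cons.IH) (auto intro: Cons.prems)
  moreover have "((\<lambda>n. wcoeff (F n * wderiv x (G n)) w) \<longlongrightarrow> wcoeff (F' * wderiv x G') w) X"
    by (rule Cons.IH) (auto intro: Cons.prems)
  ultimately show ?case by (auto simp: wcoeff_mult_Cons intro: tendsto_add)
qed

section \<open>Exponentials and linear differential systems\<close>

lemma wcoeff_mult_eq_0:
  assumes "\<And>u. length u < i \<Longrightarrow> wcoeff F u = 0" and "\<And>u. length u < j \<Longrightarrow> wcoeff G u = 0"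
    and "length w < i + j"
  shows "wcoeff (F * G) w = 0"
  using assms
proof (induction w arbitrary: F G i j)
  case Nil
  then show ?case by (cases "i = 0") auto
next
  case (Cons x w)
  have "wcoeff (wderiv x F * G) w = 0"
    by (rule Cons.IH[where i = "i - 1" and j = j]) (use Cons.prems in auto)
  moreover have "wcoeff (F * wderiv x G) w = 0"
    by (rule Cons.IH[where i = i and j = "j - 1"]) (use Cons.prems in auto)
  ultimately show ?case by (simp add: wcoeff_mult_Cons)
qed

lemma wcoeff_power_eq_0:
  assumes "wcoeff K [] = 0" and "length w < i"
  shows "wcoeff (K ^ i) w = 0"
  using assms(2)
proof (induction i arbitrary: w)
  case (Suc i)
  have "wcoeff (K * K ^ i) w = 0"
    by (rule wcoeff_mult_eq_0[where i = 1 and j = i]) (use Suc assms in auto)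
  then show ?case by simp
qed simp

text \<open>A power \<open>K ^ i\<close> of a function without constant term vanishes on words
  shorter than \<open>i\<close>, so cutting the exponential series at the length of the word loses
  nothing and no convergence is involved.\<close>

definition wexp :: "'a wfun \<Rightarrow> 'a wfun" where
  "wexp K = Abs_wfun (\<lambda>w. \<Sum>i\<le>length w. wcoeff (K ^ i) w / fact i)"

lemma wcoeff_wexp:
  assumes "wcoeff K [] = 0" and "length w \<le> N"
  shows "wcoeff (wexp K) w = (\<Sum>i\<le>N. wcoeff (K ^ i) w / fact i)"
  unfolding wexp_def wcoeff_Abs
  by (rule sum.mono_neutral_left) (use assms in \<open>auto intro!: wcoeff_power_eq_0\<close>)

lemma wcoeff_wexp_Nil [simp]: "wcoeff (wexp K) [] = 1"
  by (simp add: wexp_def wcoeff_one)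

lemma wderiv_wexp:
  fixes K :: "'a wfun"
  assumes "wcoeff K [] = 0"
  shows "wderiv x (wexp K) = wderiv x K * wexp K"
proof (rule wfun_eqI)
  fix w :: "'a list"
  let ?N = "length w"
  let ?E = "\<Sum>i\<le>?N. wconst (1 / fact i) * K ^ i"
  have "wcoeff (wderiv x (wexp K)) w = (\<Sum>i\<le>Suc ?N. wcoeff (wderiv x (K ^ i)) w / fact i)"
    using assms by (simp add: wcoeff_wexp[where N = "Suc ?N"])
  \<comment> \<open>The term \<open>i = 0\<close> has derivative zero; shifting the index cancels
    the exponent against the factorial and brings the bound from \<open>Suc ?N\<close> back to
    \<open>?N\<close>.\<close>
  also have "\<dots> = (\<Sum>i\<le>?N. wcoeff (wderiv x K * K ^ i) w / fact i)"
    unfolding sum.atMost_Suc_shift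
    by (simp add: wderiv_power mult.assoc del: wcoeff_wderiv of_nat_Suc power_Suc)
  also have "\<dots> = wcoeff (wderiv x K * ?E) w"
    by (simp add: sum_distrib_left wcoeff_sum mult.left_commute[of _ "wconst _"])
  also have "\<dots> = wcoeff (wderiv x K * wexp K) w"
    by (rule wcoeff_mult_cong) (simp_all add: wcoeff_sum wcoeff_wexp[OF assms])
  finally show "wcoeff (wderiv x (wexp K)) w = wcoeff (wderiv x K * wexp K) w" .
qed

text \<open>Uniqueness for a linear first-order system: the product formula computes the value at
  \<open>x # v\<close> from values at words no longer than \<open>v\<close>. Exponentials are
  identified in this way throughout.\<close>

lemma wfun_eq_by_wderiv:
  assumes "wcoeff F [] = wcoeff G []"
    and "\<And>x. wderiv x F = A x * F" and "\<And>x. wderiv x G = A x * G"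
  shows "F = G"
proof (rule wfun_eqI)
  fix w show "wcoeff F w = wcoeff G w"
  proof (induction w rule: length_induct)
    case (1 w)
    show ?case
    proof (cases w)
      case Nil
      then show ?thesis using assms by simp
    next
      case (Cons x v)
      have "wcoeff (wderiv x F) v = wcoeff (wderiv x G) v"
        unfolding assms(2,3) by (rule wcoeff_mult_cong) (use 1 Cons in auto)
      then show ?thesis using Cons by simp
    qed
  qed
qed

lemma wexp_add:
  assumes "wcoeff K [] = 0" and "wcoeff K' [] = 0"
  shows "wexp (K + K') = wexp K * wexp K'"
  by (rule wfun_eq_by_wderiv[where A = "\<lambda>x. wderiv x K + wderiv x K'"])
    (use assms in \<open>simp_all add: wderiv_wexp wderiv_mult algebra_simps\<close>)

lemma wexp_0 [simp]: "wexp 0 = 1"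
  by (rule wfun_eq_by_wderiv[where A = "\<lambda>x. 0"]) (simp_all add: wderiv_wexp wcoeff_one)

lemma wexp_sum:
  assumes "\<And>i. i \<in> A \<Longrightarrow> wcoeff (K i) [] = 0"
  shows "wexp (\<Sum>i\<in>A. K i) = (\<Prod>i\<in>A. wexp (K i))"
  using assms
  by (induction A rule: infinite_finite_induct) (simp_all add: wexp_add wcoeff_sum)

section \<open>Dilations and the algebraic central limit theorem\<close>

definition wdil :: "complex \<Rightarrow> 'a wfun \<Rightarrow> 'a wfun" where
  "wdil c F = Abs_wfun (\<lambda>w. c ^ length w * wcoeff F w)"

lemma wcoeff_wdil [simp]: "wcoeff (wdil c F) w = c ^ length w * wcoeff F w"
  by (simp add: wdil_def)

lemma wderiv_wdil: "wderiv x (wdil c F) = wconst c * wdil c (wderiv x F)"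
  by (rule wfun_eqI) simp

lemma wdil_mult: "wdil c (F * G) = wdil c F * wdil c G"
proof (rule wfun_eqI)
  fix w show "wcoeff (wdil c (F * G)) w = wcoeff (wdil c F * wdil c G) w"
  proof (induction w arbitrary: F G)
    case (Cons x w)
    have "wcoeff (wdil c F * wdil c G) (x # w)
        = c * wcoeff (wdil c (wderiv x F) * wdil c G) w + c * wcoeff (wdil c F * wdil c (wderiv x G)) w"
      by (simp add: wcoeff_mult_Cons wderiv_wdil mult.assoc mult.left_commute[of _ "wconst c"])
    then show ?case
      unfolding Cons.IH[symmetric] by (simp add: wcoeff_mult_Cons algebra_simps)
  qed simp
qed

lemma wdil_power: "wdil c (F ^ n) = wdil c F ^ n"
proof (induction n)
  case 0
  show ?case by (rule wfun_eqI) (simp add: wcoeff_one)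
qed (simp add: wdil_mult)

text \<open>Differentiating an \<open>n\<close>-th power produces a factor of order
  \<open>n\<close>, and a word with \<open>2 + k\<close> letters carries that many factors
  \<open>1 / sqrt n\<close>. They balance exactly for two letters, and every further letter adds a
  vanishing factor, so only the covariance survives.\<close>

lemma tendsto_scaled_power:
  "(\<lambda>n. of_nat (n - j) * (1 / complex_of_real (sqrt (real n))) ^ (2 + k)) \<longlonglongrightarrow> (if k = 0 then 1 else 0)"
proof -
  have 1: "(\<lambda>n. real (n - j) / real n) \<longlonglongrightarrow> 1"
  proof (rule Lim_transform_eventually)
    show "(\<lambda>n. 1 - real j / real n) \<longlonglongrightarrow> 1" by real_asymp
    show "\<forall>\<^sub>F n in sequentially. 1 - real j / real n = real (n - j) / real n"
      using eventually_gt_at_top[of j] by eventually_elim (simp add: of_nat_diff field_simps)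
  qed
  have 2: "(\<lambda>n. (1 / sqrt (real n)) ^ k) \<longlonglongrightarrow> (if k = 0 then 1 else 0)"
  proof (cases "k = 0")
    case False
    have "(\<lambda>n. 1 / sqrt (real n)) \<longlonglongrightarrow> 0" by real_asymp
    from tendsto_power[OF this, of k] False show ?thesis by (simp add: zero_power)
  qed simp
  have eq: "of_nat (n - j) * (1 / complex_of_real (sqrt (real n))) ^ (2 + k)
      = complex_of_real (real (n - j) / real n * (1 / sqrt (real n)) ^ k)" for n
  proof -
    have "complex_of_real (sqrt (real n)) * complex_of_real (sqrt (real n)) = of_nat n"
      by (simp flip: of_real_mult)
    then show ?thesis by (simp add: power_add power_divide power2_eq_square)
  qed
  show ?thesis
    unfolding eq using tendsto_of_real[OF tendsto_mult[OF 1 2], where 'a = complex]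
    by (cases "k = 0") simp_all
qed

definition whomog :: "nat \<Rightarrow> 'a wfun \<Rightarrow> 'a wfun" where
  "whomog k F = Abs_wfun (\<lambda>w. if length w = k then wcoeff F w else 0)"

text \<open>
  Differentiating a power consumes one factor, so the induction needs the exponents \<open>n - j\<close>.
\<close>

lemma central_limit_wfun:
  fixes K :: "'a wfun"
  assumes K0: "wcoeff K [] = 1" and K1: "\<And>x. wcoeff K [x] = 0"
  shows "(\<lambda>n. wcoeff (wdil (1 / complex_of_real (sqrt (real n))) K ^ (n - j)) w)
    \<longlonglongrightarrow> wcoeff (wexp (whomog 2 K)) w"
proof (induction w arbitrary: j rule: length_induct)
  case (1 w)
  let ?c = "\<lambda>n. 1 / complex_of_real (sqrt (real n))"
  show ?case
  proof (cases w)
    case Nil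
    then show ?thesis by (simp add: wcoeff_power_Nil K0)
  next
    case (Cons x v)
    have "(\<lambda>n. wcoeff ((of_nat (n - j) * wderiv x (wdil (?c n) K)) * wdil (?c n) K ^ (n - Suc j)) v)
        \<longlonglongrightarrow> wcoeff (wderiv x (whomog 2 K) * wexp (whomog 2 K)) v"
    proof (rule tendsto_wcoeff_mult)
      fix u :: "'a list" assume u: "length u \<le> length v"
      show "(\<lambda>n. wcoeff (wdil (?c n) K ^ (n - Suc j)) u) \<longlonglongrightarrow> wcoeff (wexp (whomog 2 K)) u"
        using 1 u Cons by simp
      show "(\<lambda>n. wcoeff (of_nat (n - j) * wderiv x (wdil (?c n) K)) u)
          \<longlonglongrightarrow> wcoeff (wderiv x (whomog 2 K)) u"
      proof (cases "length u = 0")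
        case True
        then show ?thesis by (simp add: K1 whomog_def)
      next
        case False
        then obtain k where k: "length u = Suc k" by (cases "length u") auto
        show ?thesis
          using tendsto_mult_right[OF tendsto_scaled_power[of j k], of "wcoeff K (x # u)"] k
          by (cases "k = 0") (simp_all add: whomog_def mult_ac power2_eq_square)
      qed
    qed
    then show ?thesis
      unfolding Cons wcoeff_wderiv[symmetric] wderiv_power
      by (simp add: wderiv_wexp whomog_def mult.assoc del: wcoeff_wderiv)
  qed
qed

section \<open>Length of permutations and fixed colourings\<close>

definition supported_in :: "nat set \<Rightarrow> sinf \<Rightarrow> bool" where
  "supported_in S \<tau> \<longleftrightarrow> (\<forall>k. k \<notin> S \<longrightarrow> sinf_apply \<tau> k = k)"

definition fixed_colorings :: "nat \<Rightarrow> nat set \<Rightarrow> sinf \<Rightarrow> (nat \<Rightarrow> nat) set" where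
  "fixed_colorings d S \<tau> = {f \<in> S \<rightarrow>\<^sub>E {..<d}. f \<circ> sinf_apply \<tau> = f}"

lemma sinf_apply_0 [simp]: "sinf_apply 0 = id" by transfer simp
lemma sinf_apply_add [simp]: "sinf_apply (\<sigma> + \<tau>) = sinf_apply \<sigma> \<circ> sinf_apply \<tau>" by transfer simp
lemma bij_sinf_apply: "bij (sinf_apply \<tau>)" using sinf_apply[of \<tau>] by simp
lemma inj_sinf_apply [simp]: "sinf_apply \<tau> x = sinf_apply \<tau> y \<longleftrightarrow> x = y"
  using bij_sinf_apply[of \<tau>] by (metis bij_pointE)

lemma supported_in_mono: "supported_in S \<tau> \<Longrightarrow> S \<subseteq> T \<Longrightarrow> supported_in T \<tau>"
  by (auto simp: supported_in_def)

lemma supported_in_0: "supported_in S 0"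
  by (simp add: supported_in_def)

lemma supported_in_add: "supported_in S \<sigma> \<Longrightarrow> supported_in S \<tau> \<Longrightarrow> supported_in S (\<sigma> + \<tau>)"
  by (simp add: supported_in_def)

lemma supported_in_maps_to: "supported_in S \<tau> \<Longrightarrow> k \<in> S \<Longrightarrow> sinf_apply \<tau> k \<in> S"
  unfolding supported_in_def using inj_sinf_apply by metis

lemma supported_in_compose_PiE:
  assumes "supported_in S \<tau>" and "f \<in> S \<rightarrow>\<^sub>E C"
  shows "f \<circ> sinf_apply \<tau> \<in> S \<rightarrow>\<^sub>E C"
  using assms supported_in_maps_to[OF assms(1)]
  by (auto simp: PiE_iff extensional_def supported_in_def)

lemma finite_fixed_colorings: "finite S \<Longrightarrow> finite (fixed_colorings d S \<tau>)"
  unfolding fixed_colorings_def by (rule finite_subset[OF _ finite_PiE[of S "\<lambda>_. {..<d}"]]) auto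

section \<open>Colour counts and minimal factorizations into transpositions\<close>

lemma obtain_transposition:
  assumes "1 \<le> a" "1 \<le> b" "a \<noteq> b"
  obtains \<rho> where "is_transposition \<rho>" and "sinf_apply \<rho> = Transposition.transpose a b"
proof
  have "sinf_apply (Abs_sinf (Transposition.transpose a b)) = Transposition.transpose a b"
  proof (rule Abs_sinf_inverse)
    have "\<forall>k>max a b. Transposition.transpose a b k = k"
      by (auto simp: Transposition.transpose_def)
    then show "Transposition.transpose a b \<in> {\<tau>. bij \<tau> \<and> \<tau> 0 = 0 \<and> (\<exists>k\<^sub>0. \<forall>k>k\<^sub>0. \<tau> k = k)}"
      using assms by (auto simp: Transposition.transpose_def)
  qed
  then show "sinf_apply (Abs_sinf (Transposition.transpose a b)) = Transposition.transpose a b"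
    and "is_transposition (Abs_sinf (Transposition.transpose a b))"
    using assms by (auto simp: is_transposition_def)
qed

lemma card_fixed_colorings_insert:
  assumes "finite S" "b \<notin> S" "supported_in S \<tau>"
  shows "card (fixed_colorings d (insert b S) \<tau>) = d * card (fixed_colorings d S \<tau>)"
proof -
  let ?h = "\<lambda>(c, g). g(b := c)"
  have b: "sinf_apply \<tau> b = b" using assms by (auto simp: supported_in_def)
  have b': "sinf_apply \<tau> k = b \<longleftrightarrow> k = b" for k by (metis b inj_sinf_apply)
  have inv: "g(b := c) \<circ> sinf_apply \<tau> = g(b := c) \<longleftrightarrow> g \<circ> sinf_apply \<tau> = g"
    if "g \<in> S \<rightarrow>\<^sub>E {..<d}" for g c
    using b' by (auto simp: fun_eq_iff) (metis b)
  have "fixed_colorings d (insert b S) \<tau> = ?h ` ({..<d} \<times> fixed_colorings d S \<tau>)"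
    unfolding fixed_colorings_def PiE_insert_eq using inv by auto
  moreover have "inj_on ?h ({..<d} \<times> fixed_colorings d S \<tau>)"
  proof (rule inj_onI, clarify)
    fix c g c' g'
    assume "g \<in> fixed_colorings d S \<tau>" "g' \<in> fixed_colorings d S \<tau>"
      and eq: "g(b := c) = g'(b := c')"
    then have "g b = g' b" using \<open>b \<notin> S\<close> by (auto simp: fixed_colorings_def PiE_def extensional_def)
    then have "g k = g' k" for k using fun_cong[OF eq, of k] by (auto split: if_splits)
    moreover have "c = c'" using fun_cong[OF eq, of b] by simp
    ultimately show "c = c' \<and> g = g'" by auto
  qed
  ultimately show ?thesis by (simp add: card_image card_cartesian_product)
qed

text \<open>Since \<open>\<tau>\<close> sends \<open>b\<close> to \<open>a\<close>, multiplying by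
  the transposition cuts \<open>b\<close> out of its cycle. A colouring fixed by
  \<open>\<tau>\<close> agrees at \<open>a\<close> and \<open>b\<close>, hence is recovered from its
  restriction to \<open>S\<close>.\<close>

lemma card_fixed_colorings_transpose:
  assumes "b \<notin> S" "a \<in> S" "sinf_apply \<tau> b = a"
    and \<rho>: "sinf_apply \<rho> = Transposition.transpose a b"
  shows "card (fixed_colorings d (insert b S) \<tau>) = card (fixed_colorings d S (\<rho> + \<tau>))"
proof -
  let ?h = "\<lambda>g. g(b := g a)" and ?\<sigma> = "sinf_apply (\<rho> + \<tau>)"
  have ab: "a \<noteq> b" using assms by auto
  have \<sigma>b: "?\<sigma> b = b" using assms by simp
  have \<sigma>b': "?\<sigma> k = b \<longleftrightarrow> k = b" for k by (metis \<sigma>b inj_sinf_apply)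
  have \<tau>\<sigma>: "sinf_apply \<tau> = Transposition.transpose a b \<circ> ?\<sigma>" using \<rho> by (auto simp: fun_eq_iff)
  have inv: "g(b := c) \<circ> sinf_apply \<tau> = g(b := c) \<longleftrightarrow> c = g a \<and> g \<circ> ?\<sigma> = g" for g :: "nat \<Rightarrow> nat" and c
  proof (cases "c = g a")
    case True
    then have "g(b := c) \<circ> Transposition.transpose a b = g(b := c)"
      using ab by (auto simp: fun_eq_iff Transposition.transpose_def)
    then have "g(b := c) \<circ> sinf_apply \<tau> = g(b := c) \<circ> ?\<sigma>" unfolding \<tau>\<sigma> by (metis comp_assoc)
    moreover have "g(b := c) \<circ> ?\<sigma> = g(b := c) \<longleftrightarrow> g \<circ> ?\<sigma> = g" using \<sigma>b'
      by (auto simp: fun_eq_iff simp del: sinf_apply_add) (metis \<sigma>b)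
    ultimately show ?thesis using True by simp
  next
    case False
    then have "(g(b := c) \<circ> sinf_apply \<tau>) b \<noteq> (g(b := c)) b" using ab assms(3) by auto
    then show ?thesis using False by metis
  qed
  have "fixed_colorings d (insert b S) \<tau> = ?h ` fixed_colorings d S (\<rho> + \<tau>)"
    unfolding fixed_colorings_def PiE_insert_eq using inv \<open>a \<in> S\<close> by (auto simp del: sinf_apply_add)
  moreover have "inj_on ?h (fixed_colorings d S (\<rho> + \<tau>))"
  proof (rule inj_onI)
    fix g g'
    assume "g \<in> fixed_colorings d S (\<rho> + \<tau>)" "g' \<in> fixed_colorings d S (\<rho> + \<tau>)"
      and eq: "g(b := g a) = g'(b := g' a)"
    then have "g b = g' b" using \<open>b \<notin> S\<close> by (auto simp: fixed_colorings_def PiE_def extensional_def)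
    then have "g k = g' k" for k using fun_cong[OF eq, of k] by (auto split: if_splits)
    then show "g = g'" by auto
  qed
  ultimately show ?thesis by (simp add: card_image)
qed

text \<open>Removing a point of \<open>S\<close> either deletes a fixed point, which accounts for a
  factor \<open>d\<close> on both sides, or spends one transposition to make the point fixed. The
  factorization is chosen before \<open>d\<close>, because minimality is tested with two colours and
  the trace needs any number of them.\<close>

lemma transposition_factorization_counts_colorings:
  assumes "finite S" "0 \<notin> S" "supported_in S \<tau>"
  shows "\<exists>\<rho>s. (\<forall>\<rho>\<in>set \<rho>s. is_transposition \<rho>) \<and> \<tau> = sum_list \<rho>s \<and>
    (\<forall>d. card (fixed_colorings d S \<tau>) * d ^ length \<rho>s = d ^ card S)"
  using assms
proof (induction S arbitrary: \<tau>)
  case empty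
  then have "\<tau> = 0" by (auto simp: supported_in_def sinf_apply_inject[symmetric] fun_eq_iff)
  then show ?case by (intro exI[of _ "[]"]) (simp add: fixed_colorings_def)
next
  case (insert b S)
  show ?case
  proof (cases "sinf_apply \<tau> b = b")
    case True
    then have sup: "supported_in S \<tau>" using insert.prems by (auto simp: supported_in_def)
    with insert obtain \<rho>s where "\<forall>\<rho>\<in>set \<rho>s. is_transposition \<rho>" "\<tau> = sum_list \<rho>s"
      "\<forall>d. card (fixed_colorings d S \<tau>) * d ^ length \<rho>s = d ^ card S" by auto
    then show ?thesis
      using insert.hyps sup by (intro exI[of _ \<rho>s]) (simp add: card_fixed_colorings_insert)
  next
    case False
    define a where "a = sinf_apply \<tau> b"
    have "a \<in> insert b S" unfolding a_def by (rule supported_in_maps_to) (use insert.prems in auto)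
    then have a: "a \<in> S" "a \<noteq> b" using False a_def by auto
    then have "1 \<le> a" "1 \<le> b" using insert.prems by (auto simp: Suc_le_eq intro!: gr0I)
    with a obtain \<rho> where \<rho>: "is_transposition \<rho>" "sinf_apply \<rho> = Transposition.transpose a b"
      by (metis obtain_transposition)
    have "supported_in S (\<rho> + \<tau>)"
    proof -
      have "sinf_apply (\<rho> + \<tau>) k = k" if "k \<notin> S" for k
      proof (cases "k = b")
        case True
        then show ?thesis using \<rho> a_def by simp
      next
        case False
        then have "sinf_apply \<tau> k = k" using insert.prems that by (simp add: supported_in_def)
        then show ?thesis using \<rho> False that a by (auto simp: Transposition.transpose_def)
      qed
      then show ?thesis by (simp add: supported_in_def)
    qed
    then obtain \<rho>s where \<rho>s: "\<forall>\<rho>\<in>set \<rho>s. is_transposition \<rho>" "\<rho> + \<tau> = sum_list \<rho>s"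
      "\<forall>d. card (fixed_colorings d S (\<rho> + \<tau>)) * d ^ length \<rho>s = d ^ card S"
      using insert.IH[of "\<rho> + \<tau>"] insert.prems by blast
    have "\<rho> + \<rho> = 0" using \<rho> by (simp add: sinf_apply_inject[symmetric])
    then have "\<tau> = sum_list (\<rho> # \<rho>s)"
      using \<rho>s(2) by (metis add.assoc add.left_neutral sum_list.Cons)
    then show ?thesis
      using \<rho> \<rho>s insert.hyps a a_def
      by (intro exI[of _ "\<rho> # \<rho>s"]) (auto simp: card_fixed_colorings_transpose[where a = a and \<rho> = \<rho>])
  qed
qed

text \<open>Modulo 2 the colourings satisfying the equations form a vector space over the field with
  two elements, and one more equation cuts it at most in half.\<close>

lemma card_two_colorings_constrained:
  assumes "finite S" "set ps \<subseteq> S \<times> S"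
  shows "2 ^ card S \<le> card {f \<in> S \<rightarrow>\<^sub>E {..<2::nat}. \<forall>(a, b)\<in>set ps. f a = f b} * 2 ^ length ps"
  using assms(2)
proof (induction ps)
  case Nil
  then show ?case using \<open>finite S\<close> by (simp add: card_PiE)
next
  case (Cons p ps)
  obtain a b where p: "p = (a, b)" "a \<in> S" "b \<in> S" using Cons.prems by auto
  define X where "X = {f \<in> S \<rightarrow>\<^sub>E {..<2::nat}. \<forall>(a, b)\<in>set ps. f a = f b}"
  define Y where "Y = {f \<in> X. f a = f b}"
  have fin: "finite X" unfolding X_def
    by (rule finite_subset[OF _ finite_PiE[of S "\<lambda>_. {..<2::nat}"]]) (use \<open>finite S\<close> in auto)
  have "card (X - Y) \<le> card Y"
  proof (cases "X - Y = {}")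
    case True
    then show ?thesis by (metis card.empty le0)
  next
    case False
    then obtain g where g: "g \<in> X" "g a \<noteq> g b" by (auto simp: Y_def)
    \<comment> \<open>Adding one fixed violator \<open>g\<close> modulo 2 is injective and turns
      every violator into a solution.\<close>
    let ?h = "\<lambda>f. \<lambda>x\<in>S. (f x + g x) mod 2"
    have lt2: "f x < 2" if "f \<in> X" "x \<in> S" for f x using that by (auto simp: X_def PiE_iff)
    have "inj_on ?h (X - Y)"
    proof (rule inj_onI)
      fix f f' assume f: "f \<in> X - Y" "f' \<in> X - Y" and eq: "?h f = ?h f'"
      have "f x = f' x" for x
      proof (cases "x \<in> S")
        case True
        then have "(f x + g x) mod 2 = (f' x + g x) mod 2" using fun_cong[OF eq, of x] by simp
        moreover have "f x < 2" "f' x < 2" using f True lt2 by auto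
        ultimately show ?thesis by presburger
      next
        case False
        then show ?thesis using f by (auto simp: X_def PiE_def extensional_def)
      qed
      then show "f = f'" by auto
    qed
    moreover have "?h ` (X - Y) \<subseteq> Y"
    proof
      fix h assume "h \<in> ?h ` (X - Y)"
      then obtain f where f: "f \<in> X" "f \<notin> Y" and h: "h = ?h f" by auto
      have "f a < 2" "f b < 2" "g a < 2" "g b < 2" "f a \<noteq> f b" using f g p lt2 by (auto simp: Y_def)
      then have "h a = h b" using h g p by simp presburger
      moreover have "h \<in> X"
        using f g h Cons.prems by (fastforce simp: X_def)
      ultimately show "h \<in> Y" by (simp add: Y_def)
    qed
    moreover have "finite Y" using fin by (simp add: Y_def)
    ultimately show ?thesis by (rule card_inj_on_le)
  qed
  moreover have "card X = card (X - Y) + card Y"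
  proof -
    have "Y \<subseteq> X" "finite Y" using fin by (auto simp: Y_def)
    then show ?thesis using fin by (simp add: card_Diff_subset card_mono)
  qed
  ultimately have "card X \<le> 2 * card Y" by simp
  moreover have "Y = {f \<in> S \<rightarrow>\<^sub>E {..<2::nat}. \<forall>(a, b)\<in>set (p # ps). f a = f b}"
    using p by (auto simp: X_def Y_def)
  moreover have "2 ^ card S \<le> card X * 2 ^ length ps" using Cons by (auto simp: X_def)
  ultimately show ?case using order_trans[OF _ mult_le_mono1[of "card X" "2 * card Y" "2 ^ length ps"]]
    by (simp add: mult_ac)
qed

text \<open>A factorization into \<open>m\<close> transpositions imposes \<open>m\<close> equations,
  and every two-colouring satisfying them is fixed by \<open>\<tau>\<close>; this bounds the number
  of fixed colourings from below. The constructed factorization attains equality, hence no other is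
  shorter.\<close>

theorem card_fixed_colorings:
  assumes "finite S" "0 \<notin> S" "supported_in S \<tau>"
  shows "card (fixed_colorings d S \<tau>) * d ^ sinf_length \<tau> = d ^ card S"
proof -
  obtain \<rho>s where \<rho>s: "\<forall>\<rho>\<in>set \<rho>s. is_transposition \<rho>" "\<tau> = sum_list \<rho>s"
    and count: "\<And>d. card (fixed_colorings d S \<tau>) * d ^ length \<rho>s = d ^ card S"
    using transposition_factorization_counts_colorings[OF assms] by blast
  have "sinf_length \<tau> = length \<rho>s"
    unfolding sinf_length_def
  proof (rule Least_equality)
    show "\<exists>\<rho>s'. length \<rho>s' = length \<rho>s \<and> (\<forall>\<rho>\<in>set \<rho>s'. is_transposition \<rho>) \<and> \<tau> = sum_list \<rho>s'"
      using \<rho>s by blast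
    fix m assume "\<exists>\<rho>s'. length \<rho>s' = m \<and> (\<forall>\<rho>\<in>set \<rho>s'. is_transposition \<rho>) \<and> \<tau> = sum_list \<rho>s'"
    then obtain \<rho>s' where \<rho>s': "length \<rho>s' = m" "\<forall>\<rho>\<in>set \<rho>s'. is_transposition \<rho>" "\<tau> = sum_list \<rho>s'"
      by blast
    then have "\<forall>\<rho>\<in>set \<rho>s'. \<exists>p. sinf_apply \<rho> = Transposition.transpose (fst p) (snd p)"
      by (fastforce simp: is_transposition_def)
    then obtain P where P: "\<And>\<rho>. \<rho> \<in> set \<rho>s' \<Longrightarrow>
        sinf_apply \<rho> = Transposition.transpose (fst (P \<rho>)) (snd (P \<rho>))"
      by metis
    \<comment> \<open>A competing factorization may move points outside \<open>S\<close>, so these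
      join the ground set; each of them is fixed by \<open>\<tau>\<close> and multiplies both sides
      of the count by \<open>d\<close>.\<close>
    define T where "T = fst ` P ` set \<rho>s' \<union> snd ` P ` set \<rho>s'"
    have extend: "card (fixed_colorings d (S \<union> T) \<tau>) * d ^ length \<rho>s = d ^ card (S \<union> T)"
      if "finite T" for d T
      using that
    proof induction
      case (insert b T)
      show ?case
      proof (cases "b \<in> S")
        case True
        then show ?thesis using insert by (simp add: insert_absorb)
      next
        case False
        then show ?thesis
          using insert assms supported_in_mono[OF assms(3), of "S \<union> T"]
          by (simp add: card_fixed_colorings_insert)
      qed
    qed (simp add: count)
    have fin: "finite (S \<union> T)" using assms by (simp add: T_def)
    let ?X = "{f \<in> (S \<union> T) \<rightarrow>\<^sub>E {..<2::nat}. \<forall>(a, b)\<in>set (map P \<rho>s'). f a = f b}"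
    have "?X \<subseteq> fixed_colorings 2 (S \<union> T) \<tau>"
    proof
      fix f assume f: "f \<in> ?X"
      have "f \<circ> sinf_apply \<rho> = f" if "\<rho> \<in> set \<rho>s'" for \<rho>
        using f that P[OF that] by (force simp: fun_eq_iff Transposition.transpose_def split_beta)
      then have "f \<circ> sinf_apply (sum_list \<rho>s') = f"
      proof (induction \<rho>s')
        case (Cons \<rho> \<rho>s')
        then have "f \<circ> sinf_apply \<rho> = f" "f \<circ> sinf_apply (sum_list \<rho>s') = f" by (auto simp: comp_def)
        then show ?case by (metis comp_assoc sinf_apply_add sum_list.Cons)
      qed simp
      then show "f \<in> fixed_colorings 2 (S \<union> T) \<tau>" using f \<rho>s' by (simp add: fixed_colorings_def)
    qed
    then have "card ?X \<le> card (fixed_colorings 2 (S \<union> T) \<tau>)"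
      by (intro card_mono finite_fixed_colorings fin)
    moreover have "set (map P \<rho>s') \<subseteq> (S \<union> T) \<times> (S \<union> T)"
      unfolding T_def set_map mem_Times_iff subset_iff by blast
    from card_two_colorings_constrained[OF fin this]
    have "2 ^ card (S \<union> T) \<le> card ?X * 2 ^ m"
      unfolding length_map \<rho>s'(1) .
    ultimately have "2 ^ card (S \<union> T) \<le> card (fixed_colorings 2 (S \<union> T) \<tau>) * (2::nat) ^ m"
      by (meson le_trans mult_le_mono1)
    moreover have "card (fixed_colorings 2 (S \<union> T) \<tau>) * 2 ^ length \<rho>s = 2 ^ card (S \<union> T)"
      using extend[of T 2] by (simp add: T_def)
    moreover from this have "card (fixed_colorings 2 (S \<union> T) \<tau>) > 0"
      by (metis gr0I mult_0 power_not_zero zero_neq_numeral)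
    ultimately have "(2::nat) ^ length \<rho>s \<le> 2 ^ m"
      by (metis mult_le_cancel1)
    then show "length \<rho>s \<le> m" by simp
  qed
  then show ?thesis using count by simp
qed

section \<open>Positive functionals\<close>

lemma lin_ext_0 [simp]: "lin_ext h 0 = 0"
  by (simp add: lin_ext_def)

lemma lin_ext_sum: "lin_ext h (\<Sum>i\<in>A. P i) = (\<Sum>i\<in>A. lin_ext h (P i))"
  by (induction A rule: infinite_finite_induct) (simp_all add: lin_ext_add)

lemma poly_mapping_eq_sum_single:
  "P = (\<Sum>m\<in>Poly_Mapping.keys P. Poly_Mapping.single m (Poly_Mapping.lookup P m))"
  by (rule poly_mapping_eqI)
    (auto simp: lookup_sum lookup_single when_def in_keys_iff sum.delta[OF finite_keys])

lemma lin_ext_single_times: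
  fixes Q :: "'m::monoid_add \<Rightarrow>\<^sub>0 complex"
  shows "lin_ext h (Poly_Mapping.single m c * Q) = c * lin_ext (\<lambda>m'. h (m + m')) Q"
proof -
  have "lin_ext h (Poly_Mapping.single m c * Q)
      = lin_ext h (\<Sum>m'\<in>Poly_Mapping.keys Q. Poly_Mapping.single (m + m') (c * Poly_Mapping.lookup Q m'))"
    by (subst poly_mapping_eq_sum_single[of Q]) (simp add: sum_distrib_left mult_single)
  then show ?thesis
    by (simp add: lin_ext_sum lin_ext_single) (simp add: lin_ext_def sum_distrib_left mult.assoc)
qed

lemma lin_ext_star_times:
  "lin_ext h (star P * P) = (\<Sum>u\<in>Poly_Mapping.keys P. \<Sum>v\<in>Poly_Mapping.keys P.
     cnj (Poly_Mapping.lookup P u) * Poly_Mapping.lookup P v * h (adj u + v))"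
  unfolding star_def sum_distrib_right lin_ext_sum lin_ext_single_times
  by (simp add: lin_ext_def sum_distrib_left mult.assoc)

lemma star_sum: "star (\<Sum>i\<in>A. P i) = (\<Sum>i\<in>A. star (P i))"
proof (induction A rule: infinite_finite_induct)
  case empty
  show ?case by (simp add: star_def)
next
  case (infinite A)
  then show ?case by (simp add: star_def)
qed (simp add: star_add)

lemma star_mult: "star (P * Q) = star Q * star P"
proof -
  let ?s = "\<lambda>P m. Poly_Mapping.single m (Poly_Mapping.lookup P m)"
  have "star ((\<Sum>m\<in>Poly_Mapping.keys P. ?s P m) * (\<Sum>m\<in>Poly_Mapping.keys Q. ?s Q m))
      = (\<Sum>i\<in>Poly_Mapping.keys P. \<Sum>j\<in>Poly_Mapping.keys Q. star (?s Q j) * star (?s P i))"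
    unfolding sum_product star_sum by (simp add: mult_single star_single adj_add mult.commute)
  also have "\<dots> = star Q * star P"
    unfolding star_def[of Q] star_def[of P] sum_product
    by (subst sum.swap) (simp add: star_single)
  finally show ?thesis
    by (simp flip: poly_mapping_eq_sum_single)
qed

lemma adj_0 [simp]: "adj (0 :: 'm::involutive_monoid) = 0"
  by (metis add.right_neutral adj_add adj_adj)

lemma star_scalar [simp]: "star (scalar c) = scalar (cnj c)"
  by (simp add: scalar_def star_single)

lemma scalar_1: "scalar 1 = 1"
  by (simp add: scalar_def)

lemma star_1 [simp]: "star 1 = 1"
  by (metis complex_cnj_one scalar_1 star_scalar)

lemma scalar_commute: "scalar c * P = P * scalar c"
proof -
  have "scalar c * (\<Sum>m\<in>Poly_Mapping.keys P. Poly_Mapping.single m (Poly_Mapping.lookup P m))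
      = (\<Sum>m\<in>Poly_Mapping.keys P. Poly_Mapping.single m (Poly_Mapping.lookup P m)) * scalar c"
    by (simp add: sum_distrib_left sum_distrib_right scalar_def mult_single mult.commute)
  then show ?thesis by (simp flip: poly_mapping_eq_sum_single)
qed

lemma star_uminus: "star (- P) = - star P"
proof -
  have "star P + star (- P) = star 0" by (simp flip: star_add)
  then show ?thesis by (simp add: star_def[of 0] eq_neg_iff_add_eq_0 add.commute)
qed

lemma star_diff: "star (P - Q) = star P - star Q"
  by (simp only: diff_conv_add_uminus star_add star_uminus)

lemma scalar_mult_scalar: "scalar a * scalar b = scalar (a * b)"
  by (simp add: scalar_def mult_single)

lemma cnj_mult_self_nonneg: "cnj z * z \<in> \<real>\<^sub>\<ge>\<^sub>0"
proof -
  have "cnj z * z = complex_of_real ((cmod z)\<^sup>2)" by (simp only: complex_norm_square mult.commute)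
  then show ?thesis by simp
qed

lemma nonneg_Reals_sum: "(\<And>i. i \<in> A \<Longrightarrow> f i \<in> \<real>\<^sub>\<ge>\<^sub>0) \<Longrightarrow> (\<Sum>i\<in>A. f i :: complex) \<in> \<real>\<^sub>\<ge>\<^sub>0"
  by (induction A rule: infinite_finite_induct) auto

lemma exists_common_support:
  assumes "finite A"
  shows "\<exists>S. finite S \<and> 0 \<notin> S \<and> (\<forall>\<tau>\<in>A. supported_in S \<tau>)"
proof -
  have "finite {k. sinf_apply \<tau> k \<noteq> k}" for \<tau>
  proof -
    obtain k\<^sub>0 where "\<forall>k>k\<^sub>0. sinf_apply \<tau> k = k" using sinf_apply[of \<tau>] by auto
    then have "{k. sinf_apply \<tau> k \<noteq> k} \<subseteq> {..k\<^sub>0}" using not_le by blast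
    then show ?thesis by (rule finite_subset) simp
  qed
  moreover have "sinf_apply \<tau> 0 = 0" for \<tau> using sinf_apply[of \<tau>] by auto
  ultimately show ?thesis
    using assms
    by (intro exI[of _ "\<Union>\<tau>\<in>A. {k. sinf_apply \<tau> k \<noteq> k}"]) (auto simp: supported_in_def)
qed

section \<open>The trace formula and the positivity of \<open>phi\<close>\<close>

lemma power_sinf_length_eq_colorings:
  assumes "d \<ge> 1" "finite S" "0 \<notin> S" "supported_in S \<tau>"
  shows "(1 / complex_of_nat d) ^ sinf_length \<tau>
    = (\<Sum>f\<in>S \<rightarrow>\<^sub>E {..<d}. of_bool (f = f \<circ> sinf_apply \<tau>)) / of_nat d ^ card S"
proof -
  have "of_nat (card (fixed_colorings d S \<tau>)) * complex_of_nat d ^ sinf_length \<tau> = of_nat d ^ card S"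
    using card_fixed_colorings[OF assms(2-4), of d] by (metis of_nat_mult of_nat_power)
  moreover have "(\<Sum>f\<in>S \<rightarrow>\<^sub>E {..<d}. of_bool (f = f \<circ> sinf_apply \<tau>)) = complex_of_nat (card (fixed_colorings d S \<tau>))"
  proof -
    have "finite (S \<rightarrow>\<^sub>E {..<d})" using assms by (intro finite_PiE) auto
    then have "(\<Sum>f\<in>S \<rightarrow>\<^sub>E {..<d}. of_bool (f = f \<circ> sinf_apply \<tau>))
        = complex_of_nat (card ((S \<rightarrow>\<^sub>E {..<d}) \<inter> {f. f = f \<circ> sinf_apply \<tau>}))"
      by (simp add: sum_of_bool_eq)
    also have "(S \<rightarrow>\<^sub>E {..<d}) \<inter> {f. f = f \<circ> sinf_apply \<tau>} = fixed_colorings d S \<tau>"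
      by (auto simp: fixed_colorings_def)
    finally show ?thesis .
  qed
  ultimately show ?thesis using assms(1) by (simp add: field_simps)
qed

text \<open>The matrix entry, in the basis of colourings, of the operator induced by
  \<open>P\<close>. Acting by precomposition lets the leftmost factor of a product act on
  \<open>f\<close> first, in step with recursion over a word.\<close>

definition transfer :: "(sinf \<Rightarrow>\<^sub>0 complex) \<Rightarrow> (nat \<Rightarrow> nat) \<Rightarrow> (nat \<Rightarrow> nat) \<Rightarrow> complex" where
  "transfer P f g = lin_ext (\<lambda>\<tau>. of_bool (g = f \<circ> sinf_apply \<tau>)) P"

lemma phi_eq_trace_transfer:
  assumes "d \<ge> 1" "finite S" "0 \<notin> S" "\<And>\<tau>. \<tau> \<in> Poly_Mapping.keys P \<Longrightarrow> supported_in S \<tau>"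
  shows "phi d P = (\<Sum>f\<in>S \<rightarrow>\<^sub>E {..<d}. transfer P f f) / of_nat d ^ card S"
proof -
  have "phi d P = (\<Sum>\<tau>\<in>Poly_Mapping.keys P. Poly_Mapping.lookup P \<tau> *
      ((\<Sum>f\<in>S \<rightarrow>\<^sub>E {..<d}. of_bool (f = f \<circ> sinf_apply \<tau>)) / of_nat d ^ card S))"
    unfolding phi_def lin_ext_def
    by (rule sum.cong) (use assms in \<open>simp_all add: power_sinf_length_eq_colorings\<close>)
  also have "\<dots> = (\<Sum>\<tau>\<in>Poly_Mapping.keys P. \<Sum>f\<in>S \<rightarrow>\<^sub>E {..<d}. Poly_Mapping.lookup P \<tau> *
      of_bool (f = f \<circ> sinf_apply \<tau>)) / of_nat d ^ card S"
    by (simp only: times_divide_eq_right sum_divide_distrib sum_distrib_left)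
  also have "\<dots> = (\<Sum>f\<in>S \<rightarrow>\<^sub>E {..<d}. transfer P f f) / of_nat d ^ card S"
    by (subst sum.swap) (simp add: transfer_def lin_ext_def)
  finally show ?thesis .
qed

lemma supported_in_uminus: "supported_in S \<tau> \<Longrightarrow> supported_in S (- \<tau>)"
proof -
  assume *: "supported_in S \<tau>"
  have "sinf_apply (- \<tau>) (sinf_apply \<tau> k) = k" for k
    using fun_cong[OF sinf_apply_add[of "- \<tau>" \<tau>], of k] by simp
  then show ?thesis using * unfolding supported_in_def by metis
qed

text \<open>Writing a colouring as \<open>g \<circ> sinf_apply \<sigma>\<close> turns being fixed by
  \<open>- \<sigma> + \<tau>\<close> into
  \<open>g \<circ> sinf_apply \<sigma> = g \<circ> sinf_apply \<tau>\<close>. Summing over the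
  common value \<open>f\<close> exhibits the kernel as inner products of vectors indexed by pairs
  \<open>(g, f)\<close>, which is the source of positivity.\<close>

lemma power_sinf_length_Gram:
  assumes "d \<ge> 1" "finite S" "0 \<notin> S" "supported_in S \<sigma>" "supported_in S \<tau>"
  shows "(1 / complex_of_nat d) ^ sinf_length (- \<sigma> + \<tau>)
    = (\<Sum>g\<in>S \<rightarrow>\<^sub>E {..<d}. \<Sum>f\<in>S \<rightarrow>\<^sub>E {..<d}.
        of_bool (f = g \<circ> sinf_apply \<sigma>) * of_bool (f = g \<circ> sinf_apply \<tau>)) / of_nat d ^ card S"
proof -
  let ?X = "S \<rightarrow>\<^sub>E {..<d}"
  have fin: "finite ?X" using assms by (intro finite_PiE) auto
  have inv: "sinf_apply (- \<sigma>) \<circ> sinf_apply \<sigma> = id" "sinf_apply \<sigma> \<circ> sinf_apply (- \<sigma>) = id"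
    by (simp_all flip: sinf_apply_add)
  have "(\<Sum>f\<in>?X. of_bool (f = f \<circ> sinf_apply (- \<sigma> + \<tau>)))
      = (\<Sum>g\<in>?X. complex_of_real (of_bool (g \<circ> sinf_apply \<sigma> = g \<circ> sinf_apply \<tau>)))"
  proof (rule sum.reindex_bij_witness[of _ "\<lambda>g. g \<circ> sinf_apply \<sigma>" "\<lambda>f. f \<circ> sinf_apply (- \<sigma>)"])
    fix f assume "f \<in> ?X"
    then show "f \<circ> sinf_apply (- \<sigma>) \<in> ?X"
      by (intro supported_in_compose_PiE supported_in_uminus assms)
    show "f \<circ> sinf_apply (- \<sigma>) \<circ> sinf_apply \<sigma> = f" by (simp only: comp_assoc inv comp_id)
    then show "complex_of_real (of_bool (f \<circ> sinf_apply (- \<sigma>) \<circ> sinf_apply \<sigma> = f \<circ> sinf_apply (- \<sigma>) \<circ> sinf_apply \<tau>))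
        = of_bool (f = f \<circ> sinf_apply (- \<sigma> + \<tau>))"
      by (simp add: comp_assoc)
  next
    fix g assume "g \<in> ?X"
    then show "g \<circ> sinf_apply \<sigma> \<in> ?X"
      by (intro supported_in_compose_PiE assms)
    show "g \<circ> sinf_apply \<sigma> \<circ> sinf_apply (- \<sigma>) = g" by (simp only: comp_assoc inv comp_id)
  qed
  also have "\<dots> = (\<Sum>g\<in>?X. \<Sum>f\<in>?X. of_bool (f = g \<circ> sinf_apply \<sigma>) * of_bool (f = g \<circ> sinf_apply \<tau>))"
  proof (rule sum.cong)
    fix g assume "g \<in> ?X"
    then have mem: "g \<circ> sinf_apply \<sigma> \<in> ?X" by (intro supported_in_compose_PiE assms)
    have "(\<Sum>f\<in>?X. of_bool (f = g \<circ> sinf_apply \<sigma>) * of_bool (f = g \<circ> sinf_apply \<tau>))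
        = (\<Sum>f\<in>?X. if f = g \<circ> sinf_apply \<sigma> then complex_of_real (of_bool (g \<circ> sinf_apply \<sigma> = g \<circ> sinf_apply \<tau>)) else 0)"
      by (rule sum.cong) auto
    then show "complex_of_real (of_bool (g \<circ> sinf_apply \<sigma> = g \<circ> sinf_apply \<tau>))
        = (\<Sum>f\<in>?X. of_bool (f = g \<circ> sinf_apply \<sigma>) * of_bool (f = g \<circ> sinf_apply \<tau>))"
      using fin mem by (simp add: sum.delta)
  qed simp
  finally show ?thesis
    by (simp only: power_sinf_length_eq_colorings[OF assms(1-3)
          supported_in_add[OF supported_in_uminus[OF assms(4)] assms(5)]])
qed

text \<open>A Gram representation of the kernel makes the quadratic form \<open>c\<close> times a
  sum of squared moduli.\<close>

lemma lin_ext_star_times_nonneg: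
  assumes "\<And>u v. u \<in> Poly_Mapping.keys P \<Longrightarrow> v \<in> Poly_Mapping.keys P \<Longrightarrow>
      h (adj u + v) = c * (\<Sum>i\<in>I. cnj (k u i) * k v i)"
    and "c \<in> \<real>\<^sub>\<ge>\<^sub>0"
  shows "lin_ext h (star P * P) \<in> \<real>\<^sub>\<ge>\<^sub>0"
proof -
  let ?K = "Poly_Mapping.keys P" and ?c = "Poly_Mapping.lookup P"
  define x where "x i = (\<Sum>u\<in>?K. ?c u * k u i)" for i
  have "lin_ext h (star P * P)
      = (\<Sum>u\<in>?K. \<Sum>v\<in>?K. \<Sum>i\<in>I. c * (cnj (?c u * k u i) * (?c v * k v i)))"
    unfolding lin_ext_star_times
    by (intro sum.cong refl) (simp add: assms(1) sum_distrib_left mult_ac)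
  also have "\<dots> = (\<Sum>u\<in>?K. \<Sum>i\<in>I. \<Sum>v\<in>?K. c * (cnj (?c u * k u i) * (?c v * k v i)))"
    by (intro sum.cong refl sum.swap)
  also have "\<dots> = (\<Sum>i\<in>I. \<Sum>u\<in>?K. \<Sum>v\<in>?K. c * (cnj (?c u * k u i) * (?c v * k v i)))"
    by (rule sum.swap)
  also have "\<dots> = (\<Sum>i\<in>I. c * (cnj (x i) * x i))"
    by (simp only: x_def cnj_sum sum_product) (simp only: sum_distrib_left)
  also have "\<dots> \<in> \<real>\<^sub>\<ge>\<^sub>0"
    by (intro nonneg_Reals_sum nonneg_Reals_mult_I cnj_mult_self_nonneg assms(2))
  finally show ?thesis .
qed

theorem phi_in_states:
  assumes "d \<ge> 1"
  shows "phi d \<in> states"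
proof -
  have "phi d (star P * P) \<in> \<real>\<^sub>\<ge>\<^sub>0" for P
  proof -
    obtain S where S: "finite S" "0 \<notin> S" "\<And>\<tau>. \<tau> \<in> Poly_Mapping.keys P \<Longrightarrow> supported_in S \<tau>"
      using exists_common_support[OF finite_keys[of P]] by auto
    let ?X = "S \<rightarrow>\<^sub>E {..<d}"
    define k :: "sinf \<Rightarrow> (nat \<Rightarrow> nat) \<times> (nat \<Rightarrow> nat) \<Rightarrow> complex"
      where "k \<tau> = (\<lambda>(g, f). of_bool (f = g \<circ> sinf_apply \<tau>))" for \<tau>
    have cnj_k: "cnj (k \<sigma> i) = k \<sigma> i" for \<sigma> i
      by (cases i) (simp add: k_def)
    show ?thesis
      unfolding phi_def
    proof (rule lin_ext_star_times_nonneg)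
      fix \<sigma> \<tau> assume "\<sigma> \<in> Poly_Mapping.keys P" "\<tau> \<in> Poly_Mapping.keys P"
      from power_sinf_length_Gram[OF assms S(1,2) S(3)[OF this(1)] S(3)[OF this(2)]]
      show "(1 / of_nat d) ^ sinf_length (adj \<sigma> + \<tau>)
          = complex_of_real (1 / real d ^ card S) * (\<Sum>i\<in>?X \<times> ?X. cnj (k \<sigma> i) * k \<tau> i)"
        unfolding cnj_k adj_sinf_def by (simp add: k_def sum.cartesian_product split_beta)
    next
      show "complex_of_real (1 / real d ^ card S) \<in> \<real>\<^sub>\<ge>\<^sub>0" by simp
    qed
  qed
  moreover have "phi d 1 = 1"
  proof -
    have "sinf_length 0 = 0"
      unfolding sinf_length_def by (rule Least_eq_0) simp
    then show ?thesis
      unfolding phi_def using lin_ext_single[of _ 0 1] by (metis mult_1 power_0 single_one)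
  qed
  moreover have "phi d (P + Q) = phi d P + phi d Q" "phi d (scalar c * P) = c * phi d P" for P Q c
    by (simp_all only: phi_def lin_ext_add lin_ext_scalar)
  ultimately show ?thesis
    unfolding states_def by blast
qed

section \<open>Joint distributions and their limits as states\<close>

lemma star_prod_list:
  assumes "\<And>p. star (a p) = a p"
  shows "star (prod_list (map a w)) = prod_list (map a (rev w))"
  by (induction w) (simp_all add: star_mult assms)

lemma states_sum: "\<phi> \<in> states \<Longrightarrow> \<phi> (\<Sum>i\<in>A. P i) = (\<Sum>i\<in>A. \<phi> (P i))"
proof (induction A rule: infinite_finite_induct)
  case (infinite A)
  then have "\<phi> (0 + 0) = \<phi> 0 + \<phi> 0" by (simp only: states_def mem_Collect_eq)
  then show ?case using infinite by simp
next
  case empty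
  then have "\<phi> (0 + 0) = \<phi> 0 + \<phi> 0" by (simp only: states_def mem_Collect_eq)
  then show ?case by simp
qed (simp add: states_def)

text \<open>Selfadjointness makes the star of a word in the \<open>a p\<close> the reversed word, so
  evaluating \<open>P\<close> at \<open>a\<close> gives an element \<open>X\<close> for which the
  value at \<open>star P * P\<close> is \<open>\<phi> (star X * X)\<close>.\<close>

lemma joint_distribution_in_states:
  fixes a :: "'r \<Rightarrow> ('m::involutive_monoid \<Rightarrow>\<^sub>0 complex)"
  assumes \<phi>: "\<phi> \<in> states" and a: "\<And>p. star (a p) = a p"
  shows "joint_distribution \<phi> a \<in> states"
proof -
  have scalar: "\<phi> (scalar c * P) = c * \<phi> P" for c P using \<phi> by (simp add: states_def)
  have "joint_distribution \<phi> a (star P * P) \<in> \<real>\<^sub>\<ge>\<^sub>0" for P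
  proof -
    let ?K = "Poly_Mapping.keys P" and ?c = "Poly_Mapping.lookup P"
    define A where "A w = prod_list (map a (letters w))" for w :: "'r nc_word"
    define X where "X = (\<Sum>u\<in>?K. scalar (?c u) * A u)"
    have "joint_distribution \<phi> a (star P * P) =
        (\<Sum>u\<in>?K. \<Sum>v\<in>?K. cnj (?c u) * ?c v * \<phi> (star (A u) * A v))"
      unfolding joint_distribution_def lin_ext_star_times A_def
      by (simp add: star_prod_list[OF a] adj_nc_word_def plus_nc_word_def)
    also have "\<dots> = (\<Sum>u\<in>?K. \<Sum>v\<in>?K. \<phi> (star (scalar (?c u) * A u) * (scalar (?c v) * A v)))"
    proof (intro sum.cong refl)
      fix u v
      have "star (scalar (?c u) * A u) = scalar (cnj (?c u)) * star (A u)"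
        by (subst scalar_commute) (simp add: star_mult)
      moreover have "star (A u) * (scalar (?c v) * A v) = scalar (?c v) * (star (A u) * A v)"
        by (simp only: mult.assoc[symmetric] scalar_commute[of "?c v" "star (A u)"])
      ultimately have "star (scalar (?c u) * A u) * (scalar (?c v) * A v)
          = scalar (cnj (?c u)) * (scalar (?c v) * (star (A u) * A v))"
        by (simp only: mult.assoc)
      then show "cnj (?c u) * ?c v * \<phi> (star (A u) * A v) = \<phi> (star (scalar (?c u) * A u) * (scalar (?c v) * A v))"
        by (simp add: scalar mult.assoc)
    qed
    also have "\<dots> = \<phi> (star X * X)"
      unfolding X_def star_sum sum_product by (simp add: states_sum[OF \<phi>])
    also have "\<dots> \<in> \<real>\<^sub>\<ge>\<^sub>0" using \<phi> by (simp add: states_def)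
    finally show ?thesis .
  qed
  moreover have "joint_distribution \<phi> a 1 = 1"
  proof -
    have "(1 :: 'r nc_word \<Rightarrow>\<^sub>0 complex) = nc_monom []"
      by (simp add: nc_monom_def flip: zero_nc_word_def)
    then show ?thesis
      using \<phi> joint_distribution_nc_monom[of \<phi> a "[]"] by (simp add: states_def)
  qed
  ultimately show ?thesis
    by (simp add: states_def joint_distribution_def lin_ext_add lin_ext_scalar)
qed

text \<open>All conditions are closed under pointwise limits. Membership is asked only eventually
  because the elements \<open>s p n\<close> are specified only for \<open>n \<ge> 1\<close>.\<close>

lemma limit_in_states:
  assumes "\<forall>\<^sub>F n in sequentially. \<mu>' n \<in> states" and lim: "\<And>P. (\<lambda>n. \<mu>' n P) \<longlonglongrightarrow> \<mu> P"
  shows "\<mu> \<in> states"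
proof -
  have "\<mu> (P + Q) = \<mu> P + \<mu> Q" for P Q
  proof (rule LIMSEQ_unique[OF lim])
    show "(\<lambda>n. \<mu>' n (P + Q)) \<longlonglongrightarrow> \<mu> P + \<mu> Q"
      by (rule Lim_transform_eventually[OF tendsto_add[OF lim lim]])
        (use assms(1) in eventually_elim, simp add: states_def)
  qed
  moreover have "\<mu> (scalar c * P) = c * \<mu> P" for c P
  proof (rule LIMSEQ_unique[OF lim])
    show "(\<lambda>n. \<mu>' n (scalar c * P)) \<longlonglongrightarrow> c * \<mu> P"
      by (rule Lim_transform_eventually[OF tendsto_mult_left[OF lim]])
        (use assms(1) in eventually_elim, simp add: states_def)
  qed
  moreover have "\<mu> 1 = 1"
  proof (rule LIMSEQ_unique[OF lim])
    show "(\<lambda>n. \<mu>' n 1) \<longlonglongrightarrow> 1"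
      by (rule Lim_transform_eventually[OF tendsto_const])
        (use assms(1) in eventually_elim, simp add: states_def)
  qed
  moreover have "\<mu> (star P * P) \<in> \<real>\<^sub>\<ge>\<^sub>0" for P
    by (rule Lim_in_closed_set[OF closed_nonneg_Reals_complex _ _ lim])
      (use assms(1) in \<open>auto simp: states_def elim: eventually_mono\<close>)
  ultimately show ?thesis by (simp add: states_def)
qed

section \<open>Words in the star-generators\<close>

lemma transfer_add: "transfer (P + Q) f g = transfer P f g + transfer Q f g"
  by (simp add: transfer_def lin_ext_add)

lemma transfer_scalar_times: "transfer (scalar c * P) f g = c * transfer P f g"
  by (simp add: transfer_def lin_ext_scalar)

lemma transfer_sum: "transfer (\<Sum>i\<in>A. P i) f g = (\<Sum>i\<in>A. transfer (P i) f g)"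
  by (simp add: transfer_def lin_ext_sum)

lemma transfer_diff: "transfer (P - Q) f g = transfer P f g - transfer Q f g"
  using transfer_add[of "P - Q" Q f g] by simp

lemma transfer_single_times:
  "transfer (Poly_Mapping.single \<tau> 1 * Q) f g = transfer Q (f \<circ> sinf_apply \<tau>) g"
  by (simp add: transfer_def lin_ext_single_times comp_assoc)

lemma transfer_1: "transfer 1 f g = of_bool (g = f)"
  by (simp add: transfer_def lin_ext_single flip: single_one)

text \<open>
  A letter \<open>(p, a, b)\<close> stands for the matrix entry \<open>(a, b)\<close> of the \<open>p\<close>-th matrix.  For \<open>F\<close> giving the joint
  moments of the entries, \<open>path_sum d w F a b\<close> is the expected \<open>(a, b)\<close>-entry of the matrix product along \<open>w\<close>.
\<close>

primrec path_sum :: "nat \<Rightarrow> 'r list \<Rightarrow> ('r \<times> nat \<times> nat) wfun \<Rightarrow> nat \<Rightarrow> nat \<Rightarrow> complex" where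
  "path_sum d [] F a b = of_bool (a = b) * wcoeff F []"
| "path_sum d (p # w) F a b = (\<Sum>c<d. path_sum d w (wderiv (p, a, c) F) c b)"

lemma path_sum_0 [simp]: "path_sum d w 0 a b = 0"
  by (induction w arbitrary: a) simp_all

lemma path_sum_add: "path_sum d w (F + G) a b = path_sum d w F a b + path_sum d w G a b"
  by (induction w arbitrary: F G a) (simp_all add: sum.distrib distrib_left)

lemma path_sum_diff: "path_sum d w (F - G) a b = path_sum d w F a b - path_sum d w G a b"
  by (induction w arbitrary: F G a) (simp_all add: sum_subtractf right_diff_distrib)

lemma wcoeff_wconst_Nil [simp]: "wcoeff (wconst c) [] = c"
  by transfer simp

lemma path_sum_wconst_mult: "path_sum d w (wconst k * F) a b = k * path_sum d w F a b"
  by (induction w arbitrary: F a) (simp_all add: wderiv_wconst_mult sum_distrib_left mult.left_commute)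

lemma path_sum_sum: "path_sum d w (\<Sum>i\<in>A. F i) a b = (\<Sum>i\<in>A. path_sum d w (F i) a b)"
  by (induction A rule: infinite_finite_induct) (simp_all add: path_sum_add)

text \<open>Paths visit only indices below \<open>d\<close>. The restriction matters for matrices,
  whose entries outside the dimensions carry no information.\<close>

lemma path_sum_cong:
  assumes "\<And>v. length v = length w \<Longrightarrow> set v \<subseteq> UNIV \<times> {..<d} \<times> {..<d} \<Longrightarrow> wcoeff F v = wcoeff G v" and "a < d"
  shows "path_sum d w F a b = path_sum d w G a b"
  using assms
proof (induction w arbitrary: F G a)
  case (Cons p w)
  have "path_sum d w (wderiv (p, a, c) F) c b = path_sum d w (wderiv (p, a, c) G) c b" if "c < d" for c
    by (rule Cons.IH) (use Cons.prems that in auto)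
  then show ?case by simp
qed simp

lemma path_sum_wdil: "path_sum d w (wdil c F) a b = c ^ length w * path_sum d w F a b"
  by (induction w arbitrary: F a)
    (simp_all add: wderiv_wdil path_sum_wconst_mult sum_distrib_left mult.assoc)

lemma tendsto_path_sum:
  assumes "\<And>v. ((\<lambda>n. wcoeff (F n) v) \<longlongrightarrow> wcoeff G v) X"
  shows "((\<lambda>n. path_sum d w (F n) a b) \<longlongrightarrow> path_sum d w G a b) X"
  using assms
proof (induction w arbitrary: F G a)
  case Nil
  then show ?case by (auto intro!: tendsto_mult)
next
  case (Cons p w)
  then show ?case by (auto intro!: tendsto_sum)
qed

text \<open>
  The \<open>(c, e)\<close>-entry of the product of the operators \<open>e\<^sub>b\<^sub>a - \<delta>\<^sub>a\<^sub>b / d\<close> that the letters \<open>(p, a, b)\<close> induce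
  at a single site belonging to \<open>p\<close>.
\<close>

fun site_coeff :: "nat \<Rightarrow> 'r \<Rightarrow> nat \<Rightarrow> nat \<Rightarrow> ('r \<times> nat \<times> nat) list \<Rightarrow> complex" where
  "site_coeff d p c e [] = of_bool (c = e)"
| "site_coeff d p c e ((q, a, b) # w) = (if q = p \<and> a < d \<and> b < d
     then of_bool (c = b) * site_coeff d p a e w - of_bool (a = b) / of_nat d * site_coeff d p c e w
     else 0)"

definition site :: "nat \<Rightarrow> 'r \<Rightarrow> nat \<Rightarrow> nat \<Rightarrow> ('r \<times> nat \<times> nat) wfun" where
  "site d p c e = Abs_wfun (site_coeff d p c e)"

lemma wcoeff_site_Nil [simp]: "wcoeff (site d p c e) [] = of_bool (c = e)"
  by (simp add: site_def)

lemma wderiv_site: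
  "wderiv (q, a, b) (site d p c e) = (if q = p \<and> a < d \<and> b < d
     then wconst (of_bool (c = b)) * site d p a e - wconst (of_bool (a = b) / of_nat d) * site d p c e
     else 0)"
  by (rule wfun_eqI) (simp add: site_def)

text \<open>Site 1 is common to all star transpositions and carries the moving matrix index; the
  sites in \<open>V\<close> are their other points, and \<open>lab u\<close> tells to which matrix
  the site \<open>u\<close> contributes.\<close>

locale site_labelling =
  fixes V :: "nat set" and lab :: "nat \<Rightarrow> 'r" and t :: "nat \<Rightarrow> sinf" and d :: nat
  assumes finite_V: "finite V" and V_ge: "\<And>u. u \<in> V \<Longrightarrow> u \<ge> 2" and d_ge: "d \<ge> 1"
    and t: "\<And>u. u \<in> V \<Longrightarrow> sinf_apply (t u) = Transposition.transpose 1 u"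
begin

definition sites :: "(nat \<Rightarrow> nat) \<Rightarrow> (nat \<Rightarrow> nat) \<Rightarrow> ('r \<times> nat \<times> nat) wfun" where
  "sites f g = (\<Prod>u\<in>V. site d (lab u) (f u) (g u))"

text \<open>The centring constant is distributed evenly, \<open>1 / d\<close> to each site, so that
  each site contributes centred matrix units.\<close>

definition jump :: "'r \<Rightarrow> (sinf \<Rightarrow>\<^sub>0 complex)" where
  "jump p = (\<Sum>u\<in>{u\<in>V. lab u = p}. Poly_Mapping.single (t u) 1 - scalar (1 / of_nat d))"

lemma one_notin_V: "1 \<notin> V"
  using V_ge[of 1] by auto

text \<open>The transposition of 1 and \<open>u\<close> exchanges the colours \<open>f 1\<close> and
  \<open>f u\<close>: the path at site 1 moves on to \<open>f u\<close>, and \<open>f 1\<close> is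
  left behind at \<open>u\<close>. This is how the letter \<open>(q, f 1, b)\<close> acts on the
  factor at \<open>u\<close>, and the product rule sums over the sites of \<open>q\<close>.\<close>

lemma wderiv_sites:
  assumes "f 1 < d" "b < d"
  shows "wderiv (q, f 1, b) (sites f g) = (\<Sum>u\<in>{u\<in>V. lab u = q}.
    wconst (of_bool (f u = b)) * sites (f \<circ> sinf_apply (t u)) g - wconst (of_bool (f 1 = b) / of_nat d) * sites f g)"
proof -
  let ?P = "\<lambda>u. \<Prod>v\<in>V - {u}. site d (lab v) (f v) (g v)"
  have "wderiv (q, f 1, b) (sites f g) = (\<Sum>u\<in>V. wderiv (q, f 1, b) (site d (lab u) (f u) (g u)) * ?P u)"
    unfolding sites_def by (rule wderiv_prod[OF finite_V])
  also have "\<dots> = (\<Sum>u\<in>{u\<in>V. lab u = q}. wderiv (q, f 1, b) (site d (lab u) (f u) (g u)) * ?P u)"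
    by (rule sum.mono_neutral_right) (auto simp: finite_V wderiv_site)
  also have "\<dots> = (\<Sum>u\<in>{u\<in>V. lab u = q}.
    wconst (of_bool (f u = b)) * sites (f \<circ> sinf_apply (t u)) g - wconst (of_bool (f 1 = b) / of_nat d) * sites f g)"
  proof (rule sum.cong)
    fix u assume "u \<in> {u\<in>V. lab u = q}"
    then have u: "u \<in> V" "lab u = q" by auto
    have "sites (f \<circ> sinf_apply (t u)) g = site d q (f 1) (g u) * ?P u"
    proof -
      have "(\<Prod>v\<in>V - {u}. site d (lab v) ((f \<circ> sinf_apply (t u)) v) (g v)) = ?P u"
        by (rule prod.cong) (use u one_notin_V in \<open>auto simp: t Transposition.transpose_def\<close>)
      then show ?thesis
        unfolding sites_def using u by (simp add: prod.remove[OF finite_V u(1)] t)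
    qed
    moreover have "sites f g = site d q (f u) (g u) * ?P u"
      unfolding sites_def using u by (simp add: prod.remove[OF finite_V u(1)])
    ultimately show "wderiv (q, f 1, b) (site d (lab u) (f u) (g u)) * ?P u
      = wconst (of_bool (f u = b)) * sites (f \<circ> sinf_apply (t u)) g - wconst (of_bool (f 1 = b) / of_nat d) * sites f g"
      using assms u by (simp add: wderiv_site left_diff_distrib mult.assoc)
  qed simp
  finally show ?thesis .
qed

lemma supported_in_t: "u \<in> V \<Longrightarrow> supported_in (insert 1 V) (t u)"
  by (auto simp: supported_in_def t Transposition.transpose_def)

lemma transfer_word:
  assumes "f \<in> insert 1 V \<rightarrow>\<^sub>E {..<d}" "g \<in> insert 1 V \<rightarrow>\<^sub>E {..<d}"
  shows "transfer (prod_list (map jump w)) f g = path_sum d w (sites f g) (f 1) (g 1)"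
  using assms(1)
proof (induction w arbitrary: f)
  case Nil
  have "g = f \<longleftrightarrow> f 1 = g 1 \<and> (\<forall>u\<in>V. f u = g u)"
  proof
    assume "f 1 = g 1 \<and> (\<forall>u\<in>V. f u = g u)"
    then show "g = f" by (intro PiE_ext[OF assms(2) Nil]) auto
  qed auto
  moreover have "(\<Prod>u\<in>V. of_bool (f u = g u)) = (of_bool (\<forall>u\<in>V. f u = g u) :: complex)"
    using finite_V by (induction V rule: finite_induct) auto
  ultimately show ?case
    by (simp add: transfer_1 sites_def wcoeff_prod_Nil)
next
  case (Cons p w)
  let ?Q = "prod_list (map jump w)" and ?Vp = "{u\<in>V. lab u = p}"
  have f1: "f 1 < d" and fu: "\<And>u. u \<in> V \<Longrightarrow> f u < d" using Cons.prems by auto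
  have mem: "f \<circ> sinf_apply (t u) \<in> insert 1 V \<rightarrow>\<^sub>E {..<d}" if "u \<in> V" for u
    by (rule supported_in_compose_PiE[OF supported_in_t[OF that] Cons.prems])
  have IHu: "transfer ?Q (f \<circ> sinf_apply (t u)) g = path_sum d w (sites (f \<circ> sinf_apply (t u)) g) (f u) (g 1)"
    if "u \<in> V" for u
    using Cons.IH[OF mem[OF that]] by (simp only: comp_def t[OF that] transpose_apply_first)
  have "transfer (prod_list (map jump (p # w))) f g
      = (\<Sum>u\<in>?Vp. transfer ?Q (f \<circ> sinf_apply (t u)) g - 1 / of_nat d * transfer ?Q f g)"
    by (simp add: jump_def sum_distrib_right transfer_sum left_diff_distrib transfer_diff
        transfer_single_times transfer_scalar_times)
  also have "\<dots> = (\<Sum>u\<in>?Vp. path_sum d w (sites (f \<circ> sinf_apply (t u)) g) (f u) (g 1)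
      - 1 / of_nat d * path_sum d w (sites f g) (f 1) (g 1))"
    by (rule sum.cong) (simp_all add: IHu Cons.IH[OF Cons.prems])
  \<comment> \<open>The next index of the path becomes a summation variable \<open>c\<close>: the
    transposition forces \<open>c = f u\<close>, while the centring term leaves
    \<open>c = f 1\<close>.\<close>
  also have "\<dots> = (\<Sum>u\<in>?Vp. \<Sum>c<d. of_bool (f u = c) * path_sum d w (sites (f \<circ> sinf_apply (t u)) g) c (g 1)
      - of_bool (f 1 = c) / of_nat d * path_sum d w (sites f g) c (g 1))"
  proof (rule sum.cong)
    have delta: "(\<Sum>c<d. of_bool (a = c) * h c) = h a" if "a < d" for a and h :: "nat \<Rightarrow> complex"
    proof -
      have "(\<Sum>c<d. of_bool (a = c) * h c) = (\<Sum>c<d. if a = c then h c else 0)"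
        by (rule sum.cong) auto
      then show ?thesis using that by simp
    qed
    fix u assume "u \<in> ?Vp"
    then have "f u < d" using fu by auto
    then show "path_sum d w (sites (f \<circ> sinf_apply (t u)) g) (f u) (g 1)
        - 1 / of_nat d * path_sum d w (sites f g) (f 1) (g 1)
      = (\<Sum>c<d. of_bool (f u = c) * path_sum d w (sites (f \<circ> sinf_apply (t u)) g) c (g 1)
        - of_bool (f 1 = c) / of_nat d * path_sum d w (sites f g) c (g 1))"
      using f1 delta[of "f u" "\<lambda>c. path_sum d w (sites (f \<circ> sinf_apply (t u)) g) c (g 1)"]
        delta[of "f 1" "\<lambda>c. path_sum d w (sites f g) c (g 1)"]
      by (simp add: sum_subtractf sum_divide_distrib[symmetric])
  qed simp
  also have "\<dots> = (\<Sum>c<d. \<Sum>u\<in>?Vp. of_bool (f u = c) * path_sum d w (sites (f \<circ> sinf_apply (t u)) g) c (g 1)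
      - of_bool (f 1 = c) / of_nat d * path_sum d w (sites f g) c (g 1))"
    by (rule sum.swap)
  also have "\<dots> = path_sum d (p # w) (sites f g) (f 1) (g 1)"
    unfolding path_sum.simps
  proof (rule sum.cong)
    fix c assume "c \<in> {..<d}"
    then have "wderiv (p, f 1, c) (sites f g) = (\<Sum>u\<in>?Vp.
      wconst (of_bool (f u = c)) * sites (f \<circ> sinf_apply (t u)) g - wconst (of_bool (f 1 = c) / of_nat d) * sites f g)"
      using f1 by (intro wderiv_sites) auto
    then show "(\<Sum>u\<in>?Vp. of_bool (f u = c) * path_sum d w (sites (f \<circ> sinf_apply (t u)) g) c (g 1)
        - of_bool (f 1 = c) / of_nat d * path_sum d w (sites f g) c (g 1))
      = path_sum d w (wderiv (p, f 1, c) (sites f g)) c (g 1)"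
      by (simp only: path_sum_sum path_sum_diff path_sum_wconst_mult)
  qed simp
  finally show ?case .
qed

end

definition site_trace :: "nat \<Rightarrow> 'r \<Rightarrow> ('r \<times> nat \<times> nat) wfun" where
  "site_trace d p = wconst (1 / of_nat d) * (\<Sum>c<d. site d p c c)"

lemma wconst_mult_wconst: "wconst a * wconst b = wconst (a * b)"
  by (rule wfun_eqI) (simp add: wconst.rep_eq)

lemma wconst_1: "wconst 1 = 1"
  by (rule wfun_eqI) (simp add: wconst.rep_eq wcoeff_one)

lemma prod_wconst_mult:
  "(\<Prod>i\<in>A. wconst c * F i) = wconst (c ^ card A) * (\<Prod>i\<in>A. F i)"
  by (induction A rule: infinite_finite_induct)
    (simp_all add: wconst_1 wconst_mult_wconst[symmetric] mult_ac)

context site_labelling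
begin

lemma keys_jump_supported:
  assumes "\<tau> \<in> Poly_Mapping.keys (prod_list (map jump w))"
  shows "supported_in (insert 1 V) \<tau>"
  using assms
proof (induction w arbitrary: \<tau>)
  case Nil
  then show ?case by (simp add: supported_in_0 flip: single_one split: if_splits)
next
  case (Cons p w)
  then obtain \<sigma> \<tau>' where "\<tau> = \<sigma> + \<tau>'" "\<sigma> \<in> Poly_Mapping.keys (jump p)"
    "\<tau>' \<in> Poly_Mapping.keys (prod_list (map jump w))"
    using keys_mult[of "jump p" "prod_list (map jump w)"] by auto
  moreover have "supported_in (insert 1 V) \<sigma>" if "\<sigma> \<in> Poly_Mapping.keys (jump p)"
  proof -
    from that obtain u where "u \<in> V" "\<sigma> \<in> Poly_Mapping.keys (Poly_Mapping.single (t u) 1 - scalar (1 / complex_of_nat d))"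
      using Poly_Mapping.keys_sum unfolding jump_def by fastforce
    moreover from this(2) have "\<sigma> \<in> {t u, 0}"
      using keys_diff[of "Poly_Mapping.single (t u) 1" "scalar (1 / complex_of_nat d)"]
      by (auto simp: scalar_def split: if_splits)
    ultimately show ?thesis using supported_in_0 supported_in_t by blast
  qed
  ultimately show ?case using Cons.IH supported_in_add by blast
qed

text \<open>On the diagonal \<open>f = g\<close> the colour of site 1 closes the path and the
  colours of the other sites are summed independently, turning each site into its trace. Of the
  \<open>Suc (card V)\<close> factors \<open>1 / d\<close>, one normalises the matrix trace and the
  others the site traces.\<close>

theorem phi_word:
  "phi d (prod_list (map jump w))
    = (\<Sum>a<d. path_sum d w (\<Prod>u\<in>V. site_trace d (lab u)) a a) / of_nat d"
proof -
  have S: "finite (insert 1 V)" "0 \<notin> insert 1 V" using finite_V V_ge[of 0] by auto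
  have card: "card (insert 1 V) = Suc (card V)" using finite_V one_notin_V by simp
  let ?X = "insert 1 V \<rightarrow>\<^sub>E {..<d}"
  have "phi d (prod_list (map jump w)) = (\<Sum>f\<in>?X. path_sum d w (sites f f) (f 1) (f 1)) / of_nat d ^ Suc (card V)"
    by (subst phi_eq_trace_transfer[OF d_ge S keys_jump_supported]) (simp_all add: transfer_word card del: One_nat_def)
  also have "(\<Sum>f\<in>?X. path_sum d w (sites f f) (f 1) (f 1))
      = (\<Sum>(a, f)\<in>{..<d} \<times> (V \<rightarrow>\<^sub>E {..<d}). path_sum d w (sites f f) a a)"
  proof -
    have inj: "inj_on (\<lambda>(a, f). f(1 := a)) ({..<d} \<times> (V \<rightarrow>\<^sub>E {..<d}))"
      using inj_combinator[OF one_notin_V, of "\<lambda>_. {..<d}"] .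
    have "sites (f(1 := a)) (f(1 := a)) = sites f f" for f a
      unfolding sites_def by (rule prod.cong) (use one_notin_V in auto)
    then show ?thesis
      unfolding PiE_insert_eq by (subst sum.reindex[OF inj]) (simp add: split_beta)
  qed
  also have "\<dots> = (\<Sum>a<d. path_sum d w (\<Sum>f\<in>V \<rightarrow>\<^sub>E {..<d}. sites f f) a a)"
    by (simp add: path_sum_sum sum.cartesian_product)
  also have "(\<Sum>f\<in>V \<rightarrow>\<^sub>E {..<d}. sites f f) = (\<Prod>u\<in>V. \<Sum>c<d. site d (lab u) c c)"
    unfolding sites_def by (rule prod_sum_PiE[symmetric]) (use finite_V in auto)
  finally have "phi d (prod_list (map jump w))
      = (\<Sum>a<d. path_sum d w (\<Prod>u\<in>V. \<Sum>c<d. site d (lab u) c c) a a) / of_nat d ^ Suc (card V)" .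
  then show ?thesis
    by (simp add: site_trace_def prod_wconst_mult path_sum_wconst_mult sum_distrib_left[symmetric] power_divide mult.commute
        sum_divide_distrib)
qed

end

section \<open>Covariances\<close>

lemma wcoeff_prod_singleton:
  assumes "finite A" "\<And>i. i \<in> A \<Longrightarrow> wcoeff (F i) [] = 1" "\<And>i x. i \<in> A \<Longrightarrow> wcoeff (F i) [x] = 0"
  shows "wcoeff (\<Prod>i\<in>A. F i) [x] = 0"
  using assms
proof (induction A)
  case (insert i A)
  then show ?case by (simp add: wcoeff_mult_Cons)
qed (simp add: wcoeff_one)

text \<open>If the two letters go to different factors, the term contains a one-letter coefficient
  and vanishes.\<close>

lemma wcoeff_prod_pair:
  assumes "finite A" "\<And>i. i \<in> A \<Longrightarrow> wcoeff (F i) [] = 1" "\<And>i x. i \<in> A \<Longrightarrow> wcoeff (F i) [x] = 0"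
  shows "wcoeff (\<Prod>i\<in>A. F i) [x, y] = (\<Sum>i\<in>A. wcoeff (F i) [x, y])"
  using assms
proof (induction A)
  case (insert i A)
  then show ?case
    by (simp add: wcoeff_mult_Cons wcoeff_prod_Nil wcoeff_prod_singleton)
qed (simp add: wcoeff_one)

lemma sum_of_bool_eq_mult:
  fixes a d :: nat
  assumes "a < d"
  shows "(\<Sum>c<d. of_bool (c = a) * h c) = (h a :: complex)"
proof -
  have "(\<Sum>c<d. of_bool (c = a) * h c) = (\<Sum>c<d. if c = a then h c else 0)"
    by (rule sum.cong) auto
  then show ?thesis using assms by simp
qed

lemma wcoeff_site_trace:
  "wcoeff (site_trace d p) w = (\<Sum>c<d. site_coeff d p c c w) / of_nat d"
  by (simp add: site_trace_def wcoeff_sum site_def)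

text \<open>This is the centring: the trace of the matrix unit is \<open>of_bool (a = b)\<close>,
  and the \<open>d\<close> diagonal entries of the subtracted scalar add up to the same.\<close>

lemma sum_site_coeff_singleton: "(\<Sum>c<d. site_coeff d p c c [x]) = 0"
proof -
  obtain q a b where x: "x = (q, a, b)" by (cases x)
  show ?thesis
  proof (cases "q = p \<and> a < d \<and> b < d")
    case True
    then have "(\<Sum>c<d. site_coeff d p c c [x])
        = (\<Sum>c<d. of_bool (c = b) * of_bool (a = c)) - of_bool (a = b) / of_nat d * (\<Sum>c<d. 1)"
      by (simp only: x site_coeff.simps if_True sum_subtractf sum_distrib_left of_bool_eq(2) simp_thms)
    then show ?thesis
      using True by (simp only: sum_of_bool_eq_mult) simp
  next
    case False
    then show ?thesis by (auto simp: x)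
  qed
qed

lemma wcoeff_site_trace_Nil: "d \<ge> 1 \<Longrightarrow> wcoeff (site_trace d p) [] = 1"
  by (simp add: wcoeff_site_trace)

lemma wcoeff_site_trace_singleton: "wcoeff (site_trace d p) [x] = 0"
  by (simp only: wcoeff_site_trace sum_site_coeff_singleton) simp

lemma wcoeff_site_trace_pair:
  assumes "d \<ge> 1"
  shows "wcoeff (site_trace d p) [(q, a, b), (q', a', b')] =
    of_bool (q = p \<and> q' = p \<and> a < d \<and> b < d \<and> a' < d \<and> b' < d) *
    (of_bool (a = b' \<and> a' = b) - of_bool (a = b \<and> a' = b') / of_nat d) / of_nat d"
proof (cases "q = p \<and> a < d \<and> b < d")
  case True
  let ?y = "(q', a', b')"
  have "site_coeff d p c c [(q, a, b), ?y]
      = of_bool (c = b) * site_coeff d p a c [?y] - of_bool (a = b) / of_nat d * site_coeff d p c c [?y]" for c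
    using True by (simp only: site_coeff.simps(2)[where w = "[?y]"] if_True simp_thms)
  then have "(\<Sum>c<d. site_coeff d p c c [(q, a, b), ?y])
      = (\<Sum>c<d. of_bool (c = b) * site_coeff d p a c [?y])
        - of_bool (a = b) / of_nat d * (\<Sum>c<d. site_coeff d p c c [?y])"
    by (simp only: sum_subtractf sum_distrib_left)
  \<comment> \<open>The sum over \<open>c\<close> selects \<open>c = b\<close> in the first part;
    the second contains the trace of a single letter, which is zero.\<close>
  also have "\<dots> = site_coeff d p a b [?y]"
    using True by (simp only: sum_of_bool_eq_mult sum_site_coeff_singleton mult_zero_right diff_zero)
  finally have "wcoeff (site_trace d p) [(q, a, b), ?y] = site_coeff d p a b [?y] / of_nat d"
    by (simp only: wcoeff_site_trace)
  moreover have "site_coeff d p a b [?y] = of_bool (q' = p \<and> a' < d \<and> b' < d) *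
      (of_bool (a = b' \<and> a' = b) - of_bool (a = b \<and> a' = b') / of_nat d)"
  proof (cases "q' = p \<and> a' < d \<and> b' < d")
    case True
    then show ?thesis
      by (simp only: site_coeff.simps of_bool_conj if_True simp_thms of_bool_eq mult_1
          times_divide_eq_left mult.commute[of "of_bool (a' = b')"])
  next
    case False
    then show ?thesis
      by (simp only: site_coeff.simps if_False of_bool_eq mult_zero_left)
  qed
  ultimately show ?thesis using True by simp
next
  case False
  then have "\<not> (q = p \<and> q' = p \<and> a < d \<and> b < d \<and> a' < d \<and> b' < d)" by blast
  then show ?thesis
    by (simp only: wcoeff_site_trace site_coeff.simps(2)[where w = "[(q', a', b')]"] False if_False of_bool_eq
        sum.neutral_const mult_zero_left div_0)
qed

text \<open>The expectation of a product of two GUE entries, placed on two-letter words; indices not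
  below \<open>d\<close> give 0.\<close>

definition gue_cov :: "nat \<Rightarrow> ('r \<times> nat \<times> nat) wfun" where
  "gue_cov d = Abs_wfun (\<lambda>w. case w of
     [(p, a, b), (p', a', b')] \<Rightarrow> of_bool (p = p' \<and> a = b' \<and> b = a' \<and> a < d \<and> b < d) / of_nat d
   | _ \<Rightarrow> 0)"

text \<open>The moments of the entries of scalar matrices: \<open>E\<close> gives the moments of
  scalar variables, one per label, and the entry \<open>(a, b)\<close> is that variable on the
  diagonal and 0 elsewhere.\<close>

definition diag_lift :: "nat \<Rightarrow> 'r wfun \<Rightarrow> ('r \<times> nat \<times> nat) wfun" where
  "diag_lift d E = Abs_wfun (\<lambda>w. of_bool (\<forall>(p, a, b)\<in>set w. a = b \<and> a < d) * wcoeff E (map fst w))"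

definition pair_wfun :: "complex \<Rightarrow> 'r wfun" where
  "pair_wfun c = Abs_wfun (\<lambda>w. if \<exists>p. w = [p, p] then c else 0)"

lemma length_2_cases:
  assumes "length w \<noteq> 2 \<Longrightarrow> P" and "\<And>x y. w = [x, y] \<Longrightarrow> P"
  shows P
  using assms by (cases "length w = 2") (auto simp: length_Suc_conv numeral_2_eq_2)

text \<open>In the term that the traceless covariance subtracts, one factor \<open>1 / d\<close>
  comes from the centring and the other from the normalised site trace; their product is the
  variance of the scalar part that restores it.\<close>

lemma gue_cov_decomposition:
  assumes "d \<ge> 1"
  shows "gue_cov d = whomog 2 (\<Prod>p\<in>(UNIV :: 'r::finite set). site_trace d p)
    + diag_lift d (pair_wfun (1 / of_nat d ^ 2))"
proof (rule wfun_eqI)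
  fix w :: "('r \<times> nat \<times> nat) list"
  show "wcoeff (gue_cov d) w = wcoeff (whomog 2 (\<Prod>p\<in>UNIV. site_trace d p)
    + diag_lift d (pair_wfun (1 / of_nat d ^ 2))) w"
  proof (rule length_2_cases[of w])
    assume "length w \<noteq> 2"
    then show ?thesis
      by (auto simp: gue_cov_def whomog_def diag_lift_def pair_wfun_def map_eq_Cons_conv split: list.splits)
  next
    fix x y assume w: "w = [x, y]"
    obtain q a b where x: "x = (q, a, b)" by (cases x)
    obtain q' a' b' where y: "y = (q', a', b')" by (cases y)
    have "wcoeff (\<Prod>p\<in>UNIV. site_trace d p) w = (\<Sum>p\<in>UNIV. wcoeff (site_trace d p) w)"
      unfolding w by (rule wcoeff_prod_pair) (use assms in \<open>simp_all add: wcoeff_site_trace_Nil wcoeff_site_trace_singleton\<close>)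
    \<comment> \<open>The site traces of labels other than \<open>q\<close> vanish on the first
      letter.\<close>
    also have "\<dots> = (\<Sum>p\<in>UNIV. if p = q then wcoeff (site_trace d q) w else 0)"
      by (rule sum.cong) (use assms in \<open>auto simp: w x y wcoeff_site_trace_pair\<close>)
    also have "\<dots> = wcoeff (site_trace d q) w" by simp
    finally have 1: "wcoeff (whomog 2 (\<Prod>p\<in>UNIV. site_trace d p)) w =
        of_bool (q = q' \<and> a < d \<and> b < d \<and> a' < d \<and> b' < d) *
        (of_bool (a = b' \<and> a' = b) - of_bool (a = b \<and> a' = b') / of_nat d) / of_nat d"
      using wcoeff_site_trace_pair[OF assms, of q q a b q' a' b'] by (simp add: w x y whomog_def eq_commute)
    have 2: "wcoeff (gue_cov d) w = of_bool (q = q' \<and> a = b' \<and> b = a' \<and> a < d \<and> b < d) / of_nat d"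
      by (simp add: gue_cov_def w x y)
    have 3: "wcoeff (diag_lift d (pair_wfun (1 / of_nat d ^ 2))) w =
        of_bool (q = q' \<and> a = b \<and> a < d \<and> a' = b' \<and> a' < d) / of_nat d ^ 2"
      by (simp add: diag_lift_def pair_wfun_def w x y)
    let ?G = "q = q' \<and> a < d \<and> b < d \<and> a' < d \<and> b' < d"
    have 4: "of_bool (q = q' \<and> a = b' \<and> b = a' \<and> a < d \<and> b < d)
        = (of_bool ?G * of_bool (a = b' \<and> a' = b) :: complex)"
      unfolding of_bool_conj[symmetric] by (rule arg_cong[where f = of_bool]) blast
    have 5: "of_bool (q = q' \<and> a = b \<and> a < d \<and> a' = b' \<and> a' < d)
        = (of_bool ?G * of_bool (a = b \<and> a' = b') :: complex)"
      unfolding of_bool_conj[symmetric] by (rule arg_cong[where f = of_bool]) blast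
    have "g * x / of_nat d = g * (x - y / of_nat d) / of_nat d + g * y / of_nat d ^ 2" for g x y :: complex
      by (simp add: right_diff_distrib diff_divide_distrib power2_eq_square)
    then show ?thesis
      unfolding wcoeff_add 1 2 3 4 5 .
  qed
qed

section \<open>Scalar matrices inside path sums and traces\<close>

lemma wcoeff_diag_lift_Nil [simp]: "wcoeff (diag_lift d E) [] = wcoeff E []"
  by (simp add: diag_lift_def)

lemma wderiv_diag_lift:
  "wderiv (p, a, b) (diag_lift d E) = (if a = b \<and> a < d then diag_lift d (wderiv p E) else 0)"
  by (rule wfun_eqI) (auto simp: diag_lift_def)

lemma diag_lift_add: "diag_lift d (E + E') = diag_lift d E + diag_lift d E'"
  by (rule wfun_eqI) (simp add: diag_lift_def)

lemma diag_lift_mult: "diag_lift d (E * E') = diag_lift d E * diag_lift d E'"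
proof (rule wfun_eqI)
  fix w show "wcoeff (diag_lift d (E * E')) w = wcoeff (diag_lift d E * diag_lift d E') w"
  proof (induction w arbitrary: E E')
    case (Cons x w)
    obtain p a b where x: "x = (p, a, b)" by (cases x)
    show ?case
      unfolding wcoeff_wderiv[symmetric] x wderiv_mult wderiv_diag_lift
      by (simp add: wderiv_mult diag_lift_add Cons.IH del: wcoeff_wderiv)
  qed simp
qed

text \<open>\<open>diag_lift\<close> is multiplicative and commutes with derivatives along diagonal
  letters, while both sides have zero derivative along the other letters; so they obey one
  differential equation.\<close>

lemma wexp_diag_lift:
  assumes "wcoeff E [] = 0"
  shows "wexp (diag_lift d E) = diag_lift d (wexp E)"
proof (rule wfun_eq_by_wderiv[where A = "\<lambda>x. wderiv x (diag_lift d E)"])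
  show "wderiv x (wexp (diag_lift d E)) = wderiv x (diag_lift d E) * wexp (diag_lift d E)" for x
    by (rule wderiv_wexp) (simp add: assms)
  show "wderiv x (diag_lift d (wexp E)) = wderiv x (diag_lift d E) * diag_lift d (wexp E)" for x
    by (cases x) (simp add: wderiv_diag_lift wderiv_wexp assms diag_lift_mult)
qed simp

definition path_wfun :: "nat \<Rightarrow> ('r \<times> nat \<times> nat) wfun \<Rightarrow> nat \<Rightarrow> nat \<Rightarrow> 'r wfun" where
  "path_wfun d F a b = Abs_wfun (\<lambda>w. path_sum d w F a b)"

lemma wcoeff_path_wfun [simp]: "wcoeff (path_wfun d F a b) w = path_sum d w F a b"
  by (simp add: path_wfun_def)

lemma wderiv_path_wfun:
  "wderiv p (path_wfun d F a b) = (\<Sum>c<d. path_wfun d (wderiv (p, a, c) F) c b)"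
  by (rule wfun_eqI) (simp add: wcoeff_sum)

text \<open>
  A diagonal letter does not move the path, so it can be deleted from the word.
\<close>

lemma path_sum_mult_diag_lift:
  assumes "a < d"
  shows "path_sum d w (F * diag_lift d E) a b = wcoeff (path_wfun d F a b * E) w"
  using assms
proof (induction w arbitrary: F E a)
  case (Cons p w)
  have "path_sum d (p # w) (F * diag_lift d E) a b
      = (\<Sum>c<d. wcoeff (path_wfun d (wderiv (p, a, c) F) c b * E) w)
        + (\<Sum>c<d. if c = a then wcoeff (path_wfun d F a b * wderiv p E) w else 0)"
    unfolding path_sum.simps sum.distrib[symmetric]
    by (rule sum.cong) (auto simp: wderiv_mult path_sum_add Cons.IH wderiv_diag_lift)
  also have "\<dots> = wcoeff (path_wfun d F a b * E) (p # w)"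
    using Cons.prems
    by (simp add: wcoeff_mult_Cons wderiv_path_wfun sum_distrib_right wcoeff_sum)
  finally show ?case .
qed simp

definition trace_wfun :: "nat \<Rightarrow> ('r \<times> nat \<times> nat) wfun \<Rightarrow> 'r wfun" where
  "trace_wfun d F = wconst (1 / of_nat d) * (\<Sum>a<d. path_wfun d F a a)"

lemma wcoeff_trace_wfun: "wcoeff (trace_wfun d F) w = (\<Sum>a<d. path_sum d w F a a) / of_nat d"
  by (simp add: trace_wfun_def wcoeff_sum)

text \<open>Adding independent scalars to the matrices multiplies the word moments by
  \<open>E\<close> already at the level of words, before letters are allowed to commute.\<close>

lemma trace_wfun_mult_diag_lift: "trace_wfun d (F * diag_lift d E) = trace_wfun d F * E"
proof (rule wfun_eqI)
  fix w
  show "wcoeff (trace_wfun d (F * diag_lift d E)) w = wcoeff (trace_wfun d F * E) w"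
    unfolding wcoeff_trace_wfun
    by (simp add: path_sum_mult_diag_lift trace_wfun_def mult.assoc sum_distrib_right wcoeff_sum)
qed

section \<open>Commuting exponential generating functions\<close>

lemma mfps_eqI: "(\<And>M. mfps_coeff f M = mfps_coeff g M) \<Longrightarrow> f = g"
  by transfer auto

lemma mfps_coeff_Abs [simp]: "mfps_coeff (Abs_mfps f) = f"
  by (simp add: Abs_mfps_inverse)

lemma mfps_coeff_0 [simp]: "mfps_coeff 0 M = 0" by transfer simp
lemma mfps_coeff_1: "mfps_coeff 1 M = (if M = {#} then 1 else 0)" by transfer simp
lemma mfps_coeff_add [simp]: "mfps_coeff (f + g) M = mfps_coeff f M + mfps_coeff g M"
  by transfer simp
lemma mfps_coeff_sum: "mfps_coeff (\<Sum>i\<in>A. f i) M = (\<Sum>i\<in>A. mfps_coeff (f i) M)"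
  by (induction A rule: infinite_finite_induct) auto

lemma mfps_coeff_mult: "mfps_coeff (f * g) M = (\<Sum>A | A \<subseteq># M. mfps_coeff f A * mfps_coeff g (M - A))"
  by transfer simp

lemma mfps_coeff_const_mult [simp]: "mfps_coeff (mfps_const c * g) M = c * mfps_coeff g M"
proof -
  have "mfps_coeff (mfps_const c * g) M
      = (\<Sum>A\<in>{{#}}. mfps_coeff (mfps_const c) A * mfps_coeff g (M - A))"
    unfolding mfps_coeff_mult
    by (rule sum.mono_neutral_right) (auto simp: finite_subset_mset mfps_const_def)
  then show ?thesis by (simp add: mfps_const_def)
qed

lemma mfps_coeff_var_mult:
  "mfps_coeff (mfps_var p * g) M = (if p \<in># M then mfps_coeff g (M - {#p#}) else 0)"
proof (cases "p \<in># M")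
  case True
  have "mfps_coeff (mfps_var p * g) M
      = (\<Sum>A\<in>{{#p#}}. mfps_coeff (mfps_var p) A * mfps_coeff g (M - A))"
    unfolding mfps_coeff_mult
    by (rule sum.mono_neutral_right) (use True in \<open>auto simp: finite_subset_mset mfps_var_def\<close>)
  then show ?thesis using True by (simp add: mfps_var_def)
next
  case False
  have "mfps_coeff (mfps_var p * g) M = 0"
    unfolding mfps_coeff_mult
    by (rule sum.neutral) (use False in \<open>auto simp: mfps_var_def\<close>)
  then show ?thesis using False by simp
qed

text \<open>The Euler operator, the sum over \<open>p\<close> of \<open>z_p\<close> times the
  partial derivative by \<open>z_p\<close>. On nonconstant coefficients it can be inverted, so
  identities can be checked after applying it.\<close>

definition mfps_degree_op :: "'r mfps \<Rightarrow> 'r mfps" where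
  "mfps_degree_op f = Abs_mfps (\<lambda>M. of_nat (size M) * mfps_coeff f M)"

lemma mfps_coeff_degree_op [simp]:
  "mfps_coeff (mfps_degree_op f) M = of_nat (size M) * mfps_coeff f M"
  by (simp add: mfps_degree_op_def)

lemma mfps_degree_op_mult:
  "mfps_degree_op (f * g) = mfps_degree_op f * g + f * mfps_degree_op g"
proof (rule mfps_eqI)
  fix M
  have "of_nat (size M) * (mfps_coeff f A * mfps_coeff g (M - A))
      = of_nat (size A) * mfps_coeff f A * mfps_coeff g (M - A)
        + mfps_coeff f A * (of_nat (size (M - A)) * mfps_coeff g (M - A))" if "A \<subseteq># M" for A
  proof -
    have "size M = size A + size (M - A)"
      using that by (metis size_union subset_mset.add_diff_inverse)
    then show ?thesis by (simp add: algebra_simps)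
  qed
  then show "mfps_coeff (mfps_degree_op (f * g)) M
      = mfps_coeff (mfps_degree_op f * g + f * mfps_degree_op g) M"
    by (simp add: mfps_coeff_mult sum_distrib_left sum.distrib[symmetric])
qed

definition wegf :: "'r wfun \<Rightarrow> 'r mfps" where
  "wegf F = Abs_mfps (\<lambda>M. \<Sum>w | mset w = M. wcoeff F w / fact (length w))"

lemma finite_mset_eq: "finite {w. mset w = M}"
  by (rule finite_subset[OF _ finite_lists_length_eq[of "set_mset M" "size M"]]) auto

lemma mfps_coeff_wegf: "mfps_coeff (wegf F) M = (\<Sum>w | mset w = M. wcoeff F w) / fact (size M)"
proof -
  have "(\<Sum>w | mset w = M. wcoeff F w / fact (length w)) = (\<Sum>w | mset w = M. wcoeff F w / fact (size M))"
    by (rule sum.cong) auto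
  then show ?thesis by (simp add: wegf_def sum_divide_distrib)
qed

lemma wegf_add: "wegf (F + G) = wegf F + wegf G"
  by (rule mfps_eqI) (simp add: mfps_coeff_wegf sum.distrib add_divide_distrib)

lemma wegf_1: "wegf 1 = 1"
proof (rule mfps_eqI)
  fix M :: "'a multiset"
  show "mfps_coeff (wegf 1) M = mfps_coeff 1 M"
    using finite_mset_eq[of M]
    by (cases "M = {#}") (auto simp: mfps_coeff_wegf wcoeff_one mfps_coeff_1 intro!: sum.neutral)
qed

lemma sum_mset_eq_Cons:
  assumes "M \<noteq> {#}"
  shows "(\<Sum>w | mset w = M. h w) = (\<Sum>p\<in>set_mset M. \<Sum>w | mset w = M - {#p#}. h (p # w))"
proof -
  have "(\<Sum>p\<in>set_mset M. \<Sum>w | mset w = M - {#p#}. h (p # w))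
      = (\<Sum>(p, w)\<in>(SIGMA p:set_mset M. {w. mset w = M - {#p#}}). h (p # w))"
    by (rule sum.Sigma) (auto simp: finite_mset_eq)
  also have "\<dots> = (\<Sum>w | mset w = M. h w)"
    by (rule sum.reindex_bij_witness[of _ "\<lambda>w. (hd w, tl w)" "\<lambda>(p, w). p # w"])
      (use assms in \<open>auto simp: neq_Nil_conv\<close>)
  finally show ?thesis by simp
qed

text \<open>Words of content \<open>M\<close> are sorted by their first letter; the factor
  \<open>size M\<close> turns \<open>1 / fact (size M)\<close> into the weight of words that are one
  letter shorter.\<close>

lemma mfps_degree_op_wegf:
  "mfps_degree_op (wegf F) = (\<Sum>p\<in>(UNIV :: 'r::finite set). mfps_var p * wegf (wderiv p F))"
proof (rule mfps_eqI)
  fix M :: "'r multiset"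
  have rhs: "mfps_coeff (\<Sum>p\<in>UNIV. mfps_var p * wegf (wderiv p F)) M
      = (\<Sum>p\<in>set_mset M. mfps_coeff (wegf (wderiv p F)) (M - {#p#}))"
    by (simp add: mfps_coeff_sum mfps_coeff_var_mult sum.If_cases)
  show "mfps_coeff (mfps_degree_op (wegf F)) M
      = mfps_coeff (\<Sum>p\<in>UNIV. mfps_var p * wegf (wderiv p F)) M"
  proof (cases "M = {#}")
    case False
    then obtain k where k: "size M = Suc k" by (metis size_eq_0_iff_empty not0_implies_Suc)
    have "mfps_coeff (mfps_degree_op (wegf F)) M
        = (\<Sum>p\<in>set_mset M. \<Sum>w | mset w = M - {#p#}. wcoeff F (p # w)) / fact k"
      using False k by (simp add: mfps_coeff_wegf sum_mset_eq_Cons[OF False] del: of_nat_Suc)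
    also have "\<dots> = (\<Sum>p\<in>set_mset M. mfps_coeff (wegf (wderiv p F)) (M - {#p#}))"
      unfolding sum_divide_distrib[of _ "set_mset M"]
      by (rule sum.cong) (simp_all add: mfps_coeff_wegf size_Diff_singleton k)
    finally show ?thesis by (simp only: rhs)
  qed (simp add: mfps_coeff_sum mfps_coeff_var_mult)
qed

text \<open>The Euler operator is a derivation on power series, and removal of the first letter is
  one on word functions. Linked by \<open>mfps_degree_op_wegf\<close>, they give both sides the same
  recursion in the size of \<open>M\<close>.\<close>

lemma wegf_mult: "wegf (F * G) = wegf F * wegf (G :: 'r::finite wfun)"
proof (rule mfps_eqI)
  fix M
  show "mfps_coeff (wegf (F * G)) M = mfps_coeff (wegf F * wegf G) M"
  proof (induction "size M" arbitrary: M F G)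
    case 0
    then have "M = {#}" by simp
    then show ?case by (simp add: mfps_coeff_wegf mfps_coeff_mult)
  next
    case (Suc k)
    have "of_nat (size M) * mfps_coeff (wegf (F * G)) M
        = (\<Sum>p\<in>UNIV. mfps_coeff (mfps_var p * wegf (wderiv p (F * G))) M)"
      by (simp flip: mfps_coeff_degree_op add: mfps_degree_op_wegf mfps_coeff_sum)
    also have "\<dots> = (\<Sum>p\<in>UNIV. mfps_coeff (mfps_var p * (wegf (wderiv p F) * wegf G + wegf F * wegf (wderiv p G))) M)"
    proof (rule sum.cong)
      fix p
      have "mfps_coeff (wegf (wderiv p (F * G))) (M - {#p#})
          = mfps_coeff (wegf (wderiv p F) * wegf G + wegf F * wegf (wderiv p G)) (M - {#p#})" if "p \<in># M"
      proof -
        have "k = size (M - {#p#})" using Suc.hyps(2) that by (simp add: size_Diff_singleton)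
        then show ?thesis by (simp add: wderiv_mult wegf_add Suc.hyps(1))
      qed
      then show "mfps_coeff (mfps_var p * wegf (wderiv p (F * G))) M
          = mfps_coeff (mfps_var p * (wegf (wderiv p F) * wegf G + wegf F * wegf (wderiv p G))) M"
        by (simp only: mfps_coeff_var_mult split: if_splits) simp
    qed simp
    also have "\<dots> = mfps_coeff (mfps_degree_op (wegf F) * wegf G + wegf F * mfps_degree_op (wegf G)) M"
      unfolding mfps_coeff_sum[symmetric] mfps_degree_op_wegf
      by (rule arg_cong[where f = "\<lambda>f. mfps_coeff f M"])
        (simp add: distrib_left sum.distrib sum_distrib_left sum_distrib_right mult_ac)
    also have "\<dots> = of_nat (size M) * mfps_coeff (wegf F * wegf G) M"
      by (simp only: mfps_degree_op_mult[symmetric] mfps_coeff_degree_op)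
    finally show ?case using Suc.hyps(2) by (metis mult_cancel_left of_nat_eq_0_iff Zero_not_Suc)
  qed
qed

lemma wegf_power: "wegf (F ^ n) = wegf (F :: 'r::finite wfun) ^ n"
  by (induction n) (simp_all add: wegf_1 wegf_mult)

lemma wegf_wexp:
  fixes K :: "'r::finite wfun"
  assumes "wcoeff K [] = 0"
  shows "wegf (wexp K) = mfps_exp (wegf K)"
proof (rule mfps_eqI)
  fix M :: "'r multiset"
  \<comment> \<open>A word of content \<open>M\<close> has \<open>size M\<close> letters, so higher
    powers vanish on it and the infinite sum becomes finite.\<close>
  have "mfps_coeff (wegf K ^ i) M / fact i = 0" if "i \<notin> {..size M}" for i
  proof -
    have "wcoeff (K ^ i) w = 0" if "mset w = M" for w
      by (rule wcoeff_power_eq_0[OF assms]) (use that \<open>i \<notin> {..size M}\<close> in auto)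
    then show ?thesis by (simp add: wegf_power[symmetric] mfps_coeff_wegf)
  qed
  then have "mfps_coeff (mfps_exp (wegf K)) M = (\<Sum>i\<le>size M. mfps_coeff (wegf K ^ i) M / fact i)"
    unfolding mfps_exp_def mfps_coeff_Abs by (intro suminf_finite) auto
  also have "\<dots> = (\<Sum>i\<le>size M. \<Sum>w | mset w = M. wcoeff (K ^ i) w / fact i / fact (size M))"
    by (simp add: wegf_power[symmetric] mfps_coeff_wegf sum_divide_distrib mult.commute)
  also have "\<dots> = (\<Sum>w | mset w = M. \<Sum>i\<le>size M. wcoeff (K ^ i) w / fact i / fact (size M))"
    by (rule sum.swap)
  also have "\<dots> = (\<Sum>w | mset w = M. wcoeff (wexp K) w / fact (size M))"
    by (rule sum.cong) (auto simp: wcoeff_wexp[OF assms, where N = "size M"] sum_divide_distrib)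
  finally show "mfps_coeff (wegf (wexp K)) M = mfps_coeff (mfps_exp (wegf K)) M"
    by (simp add: mfps_coeff_wegf sum_divide_distrib)
qed

text \<open>The division by 2 is the weight \<open>1 / fact 2\<close> of two-letter words: the only
  word of content \<open>{#p, p#}\<close> is \<open>[p, p]\<close>.\<close>

lemma wegf_pair_wfun:
  "wegf (pair_wfun c) = mfps_const (c / 2) * (\<Sum>p\<in>(UNIV :: 'r::finite set). mfps_var p ^ 2)"
proof (rule mfps_eqI)
  fix M :: "'r multiset"
  have var2: "mfps_coeff (mfps_var p ^ 2) M = of_bool (M = {#p, p#})" for p
  proof -
    have "p \<in># M \<and> M - {#p#} = {#p#} \<longleftrightarrow> M = {#p, p#}"
    proof
      assume "p \<in># M \<and> M - {#p#} = {#p#}"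
      then show "M = {#p, p#}" using insert_DiffM[of p M] by simp
    qed simp
    moreover have "mfps_coeff (mfps_var p) N = of_bool (N = {#p#})" for N
      by (simp add: mfps_var_def)
    then have "mfps_coeff (mfps_var p ^ 2) M = of_bool (p \<in># M \<and> M - {#p#} = {#p#})"
      by (simp add: power2_eq_square mfps_coeff_var_mult)
    ultimately show ?thesis by (simp only:)
  qed
  show "mfps_coeff (wegf (pair_wfun c)) M = mfps_coeff (mfps_const (c / 2) * (\<Sum>p\<in>UNIV. mfps_var p ^ 2)) M"
  proof (cases "\<exists>p. M = {#p, p#}")
    case True
    then obtain p where M: "M = {#p, p#}" by blast
    have "mset w = M \<longleftrightarrow> w = [p, p]" for w
    proof
      assume w: "mset w = M"
      then have "size (mset w) = 2" "set_mset (mset w) = {p}" unfolding M by simp_all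
      then have "length w = 2" "set w = {p}" by simp_all
      then have "w = replicate 2 p" by (intro replicate_eqI) auto
      then show "w = [p, p]" by (simp add: numeral_2_eq_2)
    qed (simp add: M)
    then have "mfps_coeff (wegf (pair_wfun c)) M = c / 2"
      by (simp add: mfps_coeff_wegf pair_wfun_def) (simp add: M)
    moreover have "(\<Sum>q\<in>UNIV. mfps_coeff (mfps_var q ^ 2) M) = (\<Sum>q\<in>UNIV. if q = p then 1 else 0)"
      unfolding var2 by (rule sum.cong) (auto simp: M dest: arg_cong[where f = set_mset])
    ultimately show ?thesis by (simp add: mfps_coeff_sum)
  next
    case False
    then have "wcoeff (pair_wfun c) w = 0" if "mset w = M" for w
      using that by (auto simp: pair_wfun_def)
    then show ?thesis using False by (simp add: mfps_coeff_wegf mfps_coeff_sum var2)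
  qed
qed

section \<open>Joint moments of GUE matrices\<close>

text \<open>If \<open>mom\<close> gives the moments of a variable \<open>Z\<close>, this is the
  expectation of \<open>Z ^ m\<close> times the product of the \<open>\<alpha> x * Z\<close> along
  the word. The shift \<open>m\<close> keeps the family closed under derivatives up to
  constants.\<close>

definition moment_wfun :: "('a \<Rightarrow> complex) \<Rightarrow> (nat \<Rightarrow> complex) \<Rightarrow> nat \<Rightarrow> 'a wfun" where
  "moment_wfun \<alpha> mom m = Abs_wfun (\<lambda>w. prod_list (map \<alpha> w) * mom (m + length w))"

lemma wcoeff_moment_wfun [simp]:
  "wcoeff (moment_wfun \<alpha> mom m) w = prod_list (map \<alpha> w) * mom (m + length w)"
  by (simp add: moment_wfun_def)

lemma wderiv_moment_wfun:
  "wderiv x (moment_wfun \<alpha> mom m) = wconst (\<alpha> x) * moment_wfun \<alpha> mom (Suc m)"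
  by (rule wfun_eqI) simp

text \<open>The covariance of the family \<open>\<alpha> x * Z\<close> for a single centred
  \<open>Z\<close> of variance \<open>s\<close>.\<close>

definition rank_one_cov :: "('a \<Rightarrow> complex) \<Rightarrow> complex \<Rightarrow> 'a wfun" where
  "rank_one_cov \<alpha> s = Abs_wfun (\<lambda>w. case w of [x, y] \<Rightarrow> \<alpha> x * \<alpha> y * s | _ \<Rightarrow> 0)"

text \<open>The recursion, which is integration by parts for a Gaussian, says that an extra factor
  \<open>Z\<close> is paired with any one of the remaining letters. That is the differential
  equation of the exponential of the covariance.\<close>

lemma moment_wfun_eq_wexp:
  assumes "mom 0 = 1" "mom (Suc 0) = 0" and rec: "\<And>n. mom (Suc (Suc n)) = of_nat (Suc n) * s * mom n"
  shows "moment_wfun \<alpha> mom 0 = wexp (rank_one_cov \<alpha> s)"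
proof (rule wfun_eq_by_wderiv[where A = "\<lambda>x. wderiv x (rank_one_cov \<alpha> s)"])
  \<comment> \<open>\<open>\<Lambda>\<close> is the covariance with one letter \<open>x\<close>
    already removed, up to the factor \<open>\<alpha> x\<close>.\<close>
  define \<Lambda> where "\<Lambda> = Abs_wfun (\<lambda>w. case w of [y] \<Rightarrow> \<alpha> y * s | _ \<Rightarrow> 0)"
  have deriv_cov: "wderiv x (rank_one_cov \<alpha> s) = wconst (\<alpha> x) * \<Lambda>" for x
    by (rule wfun_eqI) (auto simp: rank_one_cov_def \<Lambda>_def split: list.split)
  have deriv_\<Lambda>: "wderiv x \<Lambda> = wconst (\<alpha> x * s) * 1" for x
    by (rule wfun_eqI) (auto simp: \<Lambda>_def wcoeff_one simp del: mult_1_right split: list.split)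
  \<comment> \<open>Each letter of \<open>w\<close> can be the one taken by
    \<open>\<Lambda>\<close>, which gives the factor \<open>length w\<close>; this factor is zero
    whenever the subtraction in the index is truncated.\<close>
  have "wcoeff (\<Lambda> * moment_wfun \<alpha> mom m) w
      = of_nat (length w) * s * prod_list (map \<alpha> w) * mom (m + length w - 1)" for w m
  proof (induction w arbitrary: m)
    case Nil
    show ?case by (simp add: \<Lambda>_def)
  next
    case (Cons x w)
    have "wcoeff (\<Lambda> * moment_wfun \<alpha> mom m) (x # w)
        = \<alpha> x * s * (prod_list (map \<alpha> w) * mom (m + length w)) + \<alpha> x * wcoeff (\<Lambda> * moment_wfun \<alpha> mom (Suc m)) w"
      unfolding wcoeff_mult_Cons deriv_\<Lambda> wderiv_moment_wfun
      by (simp add: mult.left_commute[of \<Lambda> "wconst _"] mult.assoc)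
    then show ?case by (simp add: Cons.IH algebra_simps)
  qed
  from this[of 0] have "moment_wfun \<alpha> mom (Suc 0) = \<Lambda> * moment_wfun \<alpha> mom 0"
  proof (intro wfun_eqI)
    fix w
    show "wcoeff (moment_wfun \<alpha> mom (Suc 0)) w = wcoeff (\<Lambda> * moment_wfun \<alpha> mom 0) w"
      unfolding \<open>\<And>w. wcoeff (\<Lambda> * moment_wfun \<alpha> mom 0) w = _ w\<close>
      by (cases "length w") (simp_all add: assms del: of_nat_Suc)
  qed
  then show "wderiv x (moment_wfun \<alpha> mom 0) = wderiv x (rank_one_cov \<alpha> s) * moment_wfun \<alpha> mom 0" for x
    by (simp add: wderiv_moment_wfun deriv_cov mult.assoc)
  show "wderiv x (wexp (rank_one_cov \<alpha> s)) = wderiv x (rank_one_cov \<alpha> s) * wexp (rank_one_cov \<alpha> s)" for x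
    by (rule wderiv_wexp) (simp add: rank_one_cov_def)
qed (simp add: assms)

lemma gaussian_integral_recursion:
  assumes "\<sigma> > 0"
  shows "(\<integral>x. normal_density 0 \<sigma> x * x ^ Suc (Suc n) \<partial>lborel)
    = real (Suc n) * \<sigma>\<^sup>2 * (\<integral>x. normal_density 0 \<sigma> x * x ^ n \<partial>lborel)"
proof (cases "even n")
  case True
  then obtain k where n: "n = 2 * k" by auto
  have 1: "(\<integral>x. normal_density 0 \<sigma> x * x ^ (2 * k) \<partial>lborel) = fact (2 * k) / ((2 / \<sigma>\<^sup>2) ^ k * fact k)"
    using integral_normal_moment_even[OF assms, of 0 k] by simp
  have 2: "(\<integral>x. normal_density 0 \<sigma> x * x ^ (Suc (Suc (2 * k))) \<partial>lborel)
      = (2 * real (Suc k)) * (real (Suc (2 * k)) * fact (2 * k)) / ((2 / \<sigma>\<^sup>2) * (2 / \<sigma>\<^sup>2) ^ k * (real (Suc k) * fact k))"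
    using integral_normal_moment_even[OF assms, of 0 "Suc k"] by simp
  show ?thesis
    using assms unfolding n 1 2 by (simp add: divide_simps del: of_nat_Suc)
next
  case False
  then obtain k where n: "n = 2 * k + 1" by (auto elim: oddE)
  show ?thesis
    unfolding n using integral_normal_moment_odd[OF assms, of 0 k] integral_normal_moment_odd[OF assms, of 0 "Suc k"]
    by simp
qed

context prob_space
begin

lemma normal_distributed_moment:
  assumes "distributed M lborel X (normal_density 0 \<sigma>)" "\<sigma> > 0"
  shows "integrable M (\<lambda>\<omega>. X \<omega> ^ n)"
    and "(\<integral>\<omega>. X \<omega> ^ n \<partial>M) = (\<integral>x. normal_density 0 \<sigma> x * x ^ n \<partial>lborel)"
proof -
  show "(\<integral>\<omega>. X \<omega> ^ n \<partial>M) = (\<integral>x. normal_density 0 \<sigma> x * x ^ n \<partial>lborel)"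
    by (rule distributed_integral[OF assms(1), symmetric]) auto
  have "integrable lborel (\<lambda>x. normal_density 0 \<sigma> x * x ^ n)"
    using integrable_normal_moment[OF assms(2), of 0 n] by simp
  then show "integrable M (\<lambda>\<omega>. X \<omega> ^ n)"
    by (subst (asm) distributed_integrable[OF assms(1)]) auto
qed

text \<open>Independence makes the moments a product of one-variable moment functions, each the
  exponential of a rank-one covariance; the product of these exponentials is the exponential of the
  total covariance.\<close>

theorem wick:
  fixes Z :: "'t \<Rightarrow> 'a \<Rightarrow> real" and \<alpha> :: "'x \<Rightarrow> 't \<Rightarrow> complex"
  assumes "finite I" and indep: "indep_vars (\<lambda>_. borel) Z I"
    and dist: "\<And>t. t \<in> I \<Longrightarrow> distributed M lborel (Z t) (normal_density 0 (\<sigma> t))"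
    and \<sigma>: "\<And>t. t \<in> I \<Longrightarrow> \<sigma> t > 0"
  shows "integrable M (\<lambda>\<omega>. \<Prod>x\<leftarrow>w. \<Sum>t\<in>I. \<alpha> x t * Z t \<omega>)"
    and "(\<integral>\<omega>. (\<Prod>x\<leftarrow>w. \<Sum>t\<in>I. \<alpha> x t * Z t \<omega>) \<partial>M)
      = wcoeff (wexp (\<Sum>t\<in>I. rank_one_cov (\<lambda>x. \<alpha> x t) (of_real ((\<sigma> t)\<^sup>2)))) w"
proof -
  define mom where "mom t n = (\<integral>\<omega>. complex_of_real (Z t \<omega>) ^ n \<partial>M)" for t n
  have base: "integrable M (\<lambda>\<omega>. \<Prod>t\<in>I. complex_of_real (Z t \<omega>) ^ m t) \<and>
      (\<integral>\<omega>. (\<Prod>t\<in>I. complex_of_real (Z t \<omega>) ^ m t) \<partial>M) = (\<Prod>t\<in>I. mom t (m t))" for m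
  proof -
    have "indep_vars (\<lambda>_. borel) (\<lambda>t \<omega>. complex_of_real (Z t \<omega>) ^ m t) I"
      by (rule indep_vars_compose2[OF indep]) auto
    moreover have "integrable M (\<lambda>\<omega>. complex_of_real (Z t \<omega>) ^ m t)" if "t \<in> I" for t
      using normal_distributed_moment(1)[OF dist[OF that] \<sigma>[OF that], of "m t"]
      by (simp flip: of_real_power)
    ultimately show ?thesis
      unfolding mom_def using \<open>finite I\<close> indep_vars_lebesgue_integral indep_vars_integrable by blast
  qed
  \<comment> \<open>Expanding the first letter multiplies the integrand by some \<open>Z t\<close>,
    so the induction over words has to allow arbitrary powers in front.\<close>
  have "integrable M (\<lambda>\<omega>. (\<Prod>t\<in>I. complex_of_real (Z t \<omega>) ^ m t) * (\<Prod>x\<leftarrow>w. \<Sum>t\<in>I. \<alpha> x t * Z t \<omega>)) \<and>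
      (\<integral>\<omega>. (\<Prod>t\<in>I. complex_of_real (Z t \<omega>) ^ m t) * (\<Prod>x\<leftarrow>w. \<Sum>t\<in>I. \<alpha> x t * Z t \<omega>) \<partial>M)
      = wcoeff (\<Prod>t\<in>I. moment_wfun (\<lambda>x. \<alpha> x t) (mom t) (m t)) w" for m
  proof (induction w arbitrary: m)
    case Nil
    then show ?case using base by (simp add: wcoeff_prod_Nil)
  next
    case (Cons x w)
    let ?Y = "\<lambda>\<omega>. \<Prod>x\<leftarrow>w. \<Sum>t\<in>I. \<alpha> x t * Z t \<omega>"
    let ?m = "\<lambda>t. m(t := Suc (m t))"
    have split: "(\<Prod>t\<in>I. complex_of_real (Z t \<omega>) ^ m t) * (\<Prod>x\<leftarrow>x # w. \<Sum>t\<in>I. \<alpha> x t * Z t \<omega>)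
        = (\<Sum>t\<in>I. \<alpha> x t * ((\<Prod>t'\<in>I. complex_of_real (Z t' \<omega>) ^ ?m t t') * ?Y \<omega>))" for \<omega>
    proof -
      have "(\<Prod>t'\<in>I. complex_of_real (Z t' \<omega>) ^ ?m t t')
          = Z t \<omega> * (\<Prod>t\<in>I. complex_of_real (Z t \<omega>) ^ m t)" if "t \<in> I" for t
        using \<open>finite I\<close> that by (simp add: prod.remove[of I t] cong: prod.cong_simp)
      then show ?thesis
        by (simp add: sum_distrib_left sum_distrib_right mult_ac)
    qed
    have "wderiv x (\<Prod>t\<in>I. moment_wfun (\<lambda>x. \<alpha> x t) (mom t) (m t))
        = (\<Sum>t\<in>I. wconst (\<alpha> x t) * (\<Prod>t'\<in>I. moment_wfun (\<lambda>x. \<alpha> x t') (mom t') (?m t t')))"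
      unfolding wderiv_prod[OF \<open>finite I\<close>]
    proof (rule sum.cong)
      fix t assume "t \<in> I"
      then show "wderiv x (moment_wfun (\<lambda>x. \<alpha> x t) (mom t) (m t)) * (\<Prod>t'\<in>I - {t}. moment_wfun (\<lambda>x. \<alpha> x t') (mom t') (m t'))
          = wconst (\<alpha> x t) * (\<Prod>t'\<in>I. moment_wfun (\<lambda>x. \<alpha> x t') (mom t') (?m t t'))"
        using \<open>finite I\<close> by (simp add: prod.remove[of I t] wderiv_moment_wfun mult.assoc cong: prod.cong_simp)
    qed simp
    then have "wcoeff (\<Prod>t\<in>I. moment_wfun (\<lambda>x. \<alpha> x t) (mom t) (m t)) (x # w)
        = (\<Sum>t\<in>I. \<alpha> x t * wcoeff (\<Prod>t'\<in>I. moment_wfun (\<lambda>x. \<alpha> x t') (mom t') (?m t t')) w)"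
      by (simp add: wcoeff_sum flip: wcoeff_wderiv)
    then show ?case
      unfolding split using Cons.IH by (simp add: integral_sum integrable_sum)
  qed
  from this[of "\<lambda>_. 0"] have main: "integrable M (\<lambda>\<omega>. \<Prod>x\<leftarrow>w. \<Sum>t\<in>I. \<alpha> x t * Z t \<omega>)"
      "(\<integral>\<omega>. (\<Prod>x\<leftarrow>w. \<Sum>t\<in>I. \<alpha> x t * Z t \<omega>) \<partial>M) = wcoeff (\<Prod>t\<in>I. moment_wfun (\<lambda>x. \<alpha> x t) (mom t) 0) w"
    by simp_all
  have "moment_wfun (\<lambda>x. \<alpha> x t) (mom t) 0 = wexp (rank_one_cov (\<lambda>x. \<alpha> x t) (of_real ((\<sigma> t)\<^sup>2)))" if "t \<in> I" for t
  proof (rule moment_wfun_eq_wexp)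
    have mom: "mom t n = of_real (\<integral>x. normal_density 0 (\<sigma> t) x * x ^ n \<partial>lborel)" for n
      unfolding mom_def using normal_distributed_moment(2)[OF dist[OF that] \<sigma>[OF that], of n]
      by (simp flip: of_real_power)
    show "mom t 0 = 1" by (simp add: mom_def prob_space)
    show "mom t (Suc 0) = 0"
      unfolding mom using integral_normal_moment_odd[OF \<sigma>[OF that], of 0 0] by simp
    show "mom t (Suc (Suc n)) = of_nat (Suc n) * of_real ((\<sigma> t)\<^sup>2) * mom t n" for n
      unfolding mom gaussian_integral_recursion[OF \<sigma>[OF that]] by (simp del: of_nat_Suc)
  qed
  then have "(\<Prod>t\<in>I. moment_wfun (\<lambda>x. \<alpha> x t) (mom t) 0) = wexp (\<Sum>t\<in>I. rank_one_cov (\<lambda>x. \<alpha> x t) (of_real ((\<sigma> t)\<^sup>2)))"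
    by (simp add: wexp_sum rank_one_cov_def)
  with main show "integrable M (\<lambda>\<omega>. \<Prod>x\<leftarrow>w. \<Sum>t\<in>I. \<alpha> x t * Z t \<omega>)"
    "(\<integral>\<omega>. (\<Prod>x\<leftarrow>w. \<Sum>t\<in>I. \<alpha> x t * Z t \<omega>) \<partial>M)
      = wcoeff (wexp (\<Sum>t\<in>I. rank_one_cov (\<lambda>x. \<alpha> x t) (of_real ((\<sigma> t)\<^sup>2)))) w"
    by simp_all
qed

end

section \<open>Expected products of GUE matrices\<close>

lemma integral_path_sum:
  fixes F :: "'w \<Rightarrow> ('r \<times> nat \<times> nat) wfun"
  assumes "\<And>v. integrable M (\<lambda>\<omega>. wcoeff (F \<omega>) v)"
  shows "integrable M (\<lambda>\<omega>. path_sum d w (F \<omega>) a b) \<and>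
    (\<integral>\<omega>. path_sum d w (F \<omega>) a b \<partial>M) = path_sum d w (Abs_wfun (\<lambda>v. \<integral>\<omega>. wcoeff (F \<omega>) v \<partial>M)) a b"
  using assms
proof (induction w arbitrary: F a)
  case (Cons p w)
  have "wderiv (p, a, c) (Abs_wfun (\<lambda>v. \<integral>\<omega>. wcoeff (F \<omega>) v \<partial>M))
      = Abs_wfun (\<lambda>v. \<integral>\<omega>. wcoeff (wderiv (p, a, c) (F \<omega>)) v \<partial>M)" for c
    by (rule wfun_eqI) simp
  moreover have "integrable M (\<lambda>\<omega>. path_sum d w (wderiv (p, a, c) (F \<omega>)) c b) \<and>
    (\<integral>\<omega>. path_sum d w (wderiv (p, a, c) (F \<omega>)) c b \<partial>M)
      = path_sum d w (Abs_wfun (\<lambda>v. \<integral>\<omega>. wcoeff (wderiv (p, a, c) (F \<omega>)) v \<partial>M)) c b" for c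
    by (rule Cons.IH) (simp add: Cons.prems)
  ultimately show ?case by (simp add: integral_sum integrable_sum)
qed simp

lemma index_foldr_mult_eq_path_sum:
  assumes "\<And>p. M p \<in> carrier_mat d d" and "a < d" "b < d"
  shows "foldr (*) (map M w) (1\<^sub>m d) $$ (a, b)
    = path_sum d w (Abs_wfun (\<lambda>v. \<Prod>(p, i, j)\<leftarrow>v. M p $$ (i, j))) a b"
  using assms(2)
proof (induction w arbitrary: a)
  case Nil
  then show ?case using assms(3) by simp
next
  case (Cons p w)
  let ?F = "Abs_wfun (\<lambda>v. \<Prod>(p, i, j)\<leftarrow>v. M p $$ (i, j))"
  have carrier: "foldr (*) (map M w) (1\<^sub>m d) \<in> carrier_mat d d"
    by (induction w) (auto intro!: mult_carrier_mat assms(1))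
  have "foldr (*) (map M (p # w)) (1\<^sub>m d) $$ (a, b)
      = (\<Sum>c<d. M p $$ (a, c) * foldr (*) (map M w) (1\<^sub>m d) $$ (c, b))"
    using carrier assms(1)[of p] Cons.prems assms(3)
    by (auto simp: scalar_prod_def atLeast0LessThan intro!: sum.cong)
  also have "\<dots> = (\<Sum>c<d. path_sum d w (wconst (M p $$ (a, c)) * ?F) c b)"
    by (rule sum.cong) (simp_all add: Cons.IH path_sum_wconst_mult)
  also have "\<dots> = (\<Sum>c<d. path_sum d w (wderiv (p, a, c) ?F) c b)"
    by (rule sum.cong, simp, rule arg_cong[where f = "\<lambda>F. path_sum d w F _ b"], rule wfun_eqI) simp
  finally show ?case by simp
qed

lemma sum_of_bool_eq_times:
  "finite A \<Longrightarrow> (\<Sum>q\<in>A. of_bool (q = q\<^sub>0) * h q) = (if q\<^sub>0 \<in> A then h q\<^sub>0 else (0 :: complex))"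
  by (simp add: of_bool_def if_distrib[of "\<lambda>b. b * h _"] cong: if_cong)

context
  fixes d :: nat
begin

definition gue_index :: "('r \<times> nat \<times> nat + 'r \<times> nat \<times> nat) set" where
  "gue_index = {(p, i, j). i \<le> j \<and> j < d} <+> {(p, i, j). i < j \<and> j < d}"

definition gue_sd :: "'r \<times> nat \<times> nat + 'r \<times> nat \<times> nat \<Rightarrow> real" where
  "gue_sd = case_sum (\<lambda>(p, i, j). if i = j then sqrt (1 / d) else sqrt (1 / (2 * d)))
     (\<lambda>_. sqrt (1 / (2 * d)))"

fun ordered_label :: "'r \<times> nat \<times> nat \<Rightarrow> 'r \<times> nat \<times> nat" where
  "ordered_label (p, a, b) = (p, min a b, max a b)"

fun orientation :: "'r \<times> nat \<times> nat \<Rightarrow> complex" where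
  "orientation (p, a, b) = (if a < b then 1 else if b < a then -1 else 0)"

text \<open>Both triangles of the matrix refer to the same real variables;
  \<open>orientation\<close> supplies the sign of the imaginary part and removes it on the diagonal.
  With complex coefficients every entry becomes a linear form in independent Gaussians, as
  \<open>wick\<close> requires.\<close>

definition gue_coeff :: "'r \<times> nat \<times> nat \<Rightarrow> 'r \<times> nat \<times> nat + 'r \<times> nat \<times> nat \<Rightarrow> complex" where
  "gue_coeff x = case_sum (\<lambda>q. of_bool (q = ordered_label x)) (\<lambda>q. of_bool (q = ordered_label x) * (\<i> * orientation x))"

lemma finite_gue_index_parts:
  "finite {(p :: 'r::finite, i, j). i \<le> j \<and> j < d}" "finite {(p :: 'r::finite, i, j). i < j \<and> j < d}"
  by (rule finite_subset[of _ "UNIV \<times> {..<d} \<times> {..<d}"]; auto)+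

lemma sum_gue_index:
  fixes h :: "'r::finite \<times> nat \<times> nat + 'r \<times> nat \<times> nat \<Rightarrow> complex"
  assumes "a < d" "b < d"
  shows "(\<Sum>t\<in>gue_index. gue_coeff (p, a, b) t * h t)
    = h (Inl (ordered_label (p, a, b))) + \<i> * orientation (p, a, b) * h (Inr (ordered_label (p, a, b)))"
proof -
  have "(\<Sum>t\<in>gue_index. gue_coeff (p, a, b) t * h t)
      = (\<Sum>q\<in>{(p, i, j). i \<le> j \<and> j < d}. of_bool (q = ordered_label (p, a, b)) * h (Inl q))
      + (\<Sum>q\<in>{(p, i, j). i < j \<and> j < d}. of_bool (q = ordered_label (p, a, b)) * (\<i> * orientation (p, a, b) * h (Inr q)))"
    unfolding gue_index_def by (subst sum.Plus) (simp_all add: finite_gue_index_parts gue_coeff_def mult.assoc)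
  then show ?thesis
    using assms by (auto simp: sum_of_bool_eq_times finite_gue_index_parts)
qed

lemma sum_gue_index_outside:
  fixes h :: "'r::finite \<times> nat \<times> nat + 'r \<times> nat \<times> nat \<Rightarrow> complex"
  assumes "\<not> (a < d \<and> b < d)"
  shows "(\<Sum>t\<in>gue_index. gue_coeff (p, a, b) t * h t) = 0"
  by (rule sum.neutral) (use assms in \<open>auto simp: gue_index_def gue_coeff_def\<close>)

lemma gue_matrix_index:
  fixes \<xi> \<eta> :: "'r::finite \<Rightarrow> nat \<Rightarrow> nat \<Rightarrow> 'w \<Rightarrow> real"
  assumes "a < d" "b < d"
  shows "gue_matrix d (\<xi> p) (\<eta> p) \<omega> $$ (a, b) = (\<Sum>t\<in>gue_index. gue_coeff (p, a, b) t *
    of_real (case_sum (\<lambda>(p, i, j). \<xi> p i j) (\<lambda>(p, i, j). \<eta> p i j) t \<omega>))"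
  unfolding sum_gue_index[OF assms] using assms by (auto simp: gue_matrix_def)

text \<open>Off the diagonal the real and imaginary parts have variance \<open>1 / (2 * d)\<close>
  each. Their contributions add up to \<open>1 / d\<close> for opposite orientations and cancel for
  equal ones because \<open>\<i> * \<i> = -1\<close>; on the diagonal only the real variable
  remains, with variance \<open>1 / d\<close>.\<close>

lemma gue_cov_eq_sum_rank_one:
  assumes "d \<ge> 1"
  shows "(\<Sum>t\<in>(gue_index :: ('r::finite \<times> nat \<times> nat + 'r \<times> nat \<times> nat) set).
    rank_one_cov (\<lambda>x. gue_coeff x t) (of_real ((gue_sd t)\<^sup>2))) = gue_cov d"
proof (rule wfun_eqI)
  fix w :: "('r \<times> nat \<times> nat) list"
  show "wcoeff (\<Sum>t\<in>gue_index. rank_one_cov (\<lambda>x. gue_coeff x t) (of_real ((gue_sd t)\<^sup>2))) w = wcoeff (gue_cov d) w"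
  proof (rule length_2_cases[of w])
    assume "length w \<noteq> 2"
    then show ?thesis
      by (auto simp: wcoeff_sum gue_cov_def rank_one_cov_def split: list.split intro!: sum.neutral)
  next
    fix x y assume w: "w = [x, y]"
    obtain p a b where x: "x = (p, a, b)" by (cases x)
    obtain p' a' b' where y: "y = (p', a', b')" by (cases y)
    have lhs: "wcoeff (\<Sum>t\<in>gue_index. rank_one_cov (\<lambda>x. gue_coeff x t) (of_real ((gue_sd t)\<^sup>2))) w
        = (\<Sum>t\<in>gue_index. gue_coeff x t * (gue_coeff y t * of_real ((gue_sd t)\<^sup>2)))"
      by (simp add: wcoeff_sum rank_one_cov_def w mult.assoc)
    have rhs: "wcoeff (gue_cov d) w = of_bool (p = p' \<and> a = b' \<and> b = a' \<and> a < d \<and> b < d) / of_nat d"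
      by (simp add: gue_cov_def w x y)
    show ?thesis
    proof (cases "a < d \<and> b < d")
      case False
      then show ?thesis
        unfolding lhs rhs x sum_gue_index_outside[OF False] by auto
    next
      case True
      show ?thesis
        unfolding lhs rhs x sum_gue_index[OF conjunct1[OF True] conjunct2[OF True]]
        using True assms unfolding y
        by (cases a b rule: linorder_cases; cases a' b' rule: linorder_cases)
          (simp_all add: gue_coeff_def gue_sd_def field_simps, blast)
    qed
  qed
qed

theorem gue_distribution_eq_trace_wexp:
  fixes \<xi> \<eta> :: "'r::finite \<Rightarrow> nat \<Rightarrow> nat \<Rightarrow> 'w \<Rightarrow> real"
  assumes "d \<ge> 1" and gue: "gue_entries d \<Omega> \<xi> \<eta>"
  shows "gue_distribution d \<Omega> \<xi> \<eta> (nc_monom w) = wcoeff (trace_wfun d (wexp (gue_cov d))) w"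
proof -
  interpret prob_space \<Omega> using gue by (simp add: gue_entries_def)
  let ?Z = "case_sum (\<lambda>(p, i, j). \<xi> p i j) (\<lambda>(p, i, j). \<eta> p i j)"
  let ?I = "gue_index :: ('r \<times> nat \<times> nat + 'r \<times> nat \<times> nat) set"
  have fin: "finite ?I" unfolding gue_index_def by (intro finite_Plus finite_gue_index_parts)
  have indep: "indep_vars (\<lambda>_. borel) ?Z ?I"
    using gue by (simp add: gue_entries_def gue_index_def)
  have dist: "distributed \<Omega> lborel (?Z t) (normal_density 0 (gue_sd t))" if "t \<in> ?I" for t
    using that gue by (auto simp: gue_entries_def gue_index_def gue_sd_def)
  have sd: "gue_sd t > 0" for t :: "'r \<times> nat \<times> nat + 'r \<times> nat \<times> nat"
    using assms(1) by (auto simp: gue_sd_def split: sum.split)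
  define F where "F \<omega> = Abs_wfun (\<lambda>v. \<Prod>x\<leftarrow>v. \<Sum>t\<in>?I. gue_coeff x t * ?Z t \<omega>)" for \<omega>
  note wick = wick[where \<alpha> = gue_coeff, OF fin indep dist sd, unfolded gue_cov_eq_sum_rank_one[OF assms(1)]]
  have int: "integrable \<Omega> (\<lambda>\<omega>. wcoeff (F \<omega>) v)" for v
    unfolding F_def wcoeff_Abs using wick(1) .
  have EF: "Abs_wfun (\<lambda>v. \<integral>\<omega>. wcoeff (F \<omega>) v \<partial>\<Omega>) = wexp (gue_cov d)"
    by (rule wfun_eqI) (simp only: F_def wcoeff_Abs wick(2))
  have carrier: "gue_matrix d (\<xi> p) (\<eta> p) \<omega> \<in> carrier_mat d d" for p \<omega>
    by (simp add: gue_matrix_def)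
  have product_carrier: "foldr (*) (map (\<lambda>p. gue_matrix d (\<xi> p) (\<eta> p) \<omega>) w) (1\<^sub>m d) \<in> carrier_mat d d" for \<omega>
    by (induction w) (auto intro!: mult_carrier_mat carrier)
  have "normalized_trace (foldr (*) (map (\<lambda>p. gue_matrix d (\<xi> p) (\<eta> p) \<omega>) w) (1\<^sub>m d))
      = (\<Sum>a<d. path_sum d w (F \<omega>) a a) / of_nat d" for \<omega>
  proof -
    have "foldr (*) (map (\<lambda>p. gue_matrix d (\<xi> p) (\<eta> p) \<omega>) w) (1\<^sub>m d) $$ (a, a) = path_sum d w (F \<omega>) a a"
      if "a < d" for a
    proof -
      have "foldr (*) (map (\<lambda>p. gue_matrix d (\<xi> p) (\<eta> p) \<omega>) w) (1\<^sub>m d) $$ (a, a)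
          = path_sum d w (Abs_wfun (\<lambda>v. \<Prod>(p, i, j)\<leftarrow>v. gue_matrix d (\<xi> p) (\<eta> p) \<omega> $$ (i, j))) a a"
        by (rule index_foldr_mult_eq_path_sum[OF carrier that that])
      also have "\<dots> = path_sum d w (F \<omega>) a a"
      proof (rule path_sum_cong[OF _ that])
        fix v :: "('r \<times> nat \<times> nat) list" assume "set v \<subseteq> UNIV \<times> {..<d} \<times> {..<d}"
        then show "wcoeff (Abs_wfun (\<lambda>v. \<Prod>(p, i, j)\<leftarrow>v. gue_matrix d (\<xi> p) (\<eta> p) \<omega> $$ (i, j))) v = wcoeff (F \<omega>) v"
          unfolding F_def wcoeff_Abs
          by (intro arg_cong[where f = prod_list] map_cong refl) (auto simp: gue_matrix_index)
      qed
      finally show ?thesis .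
    qed
    then show ?thesis
      using product_carrier[of \<omega>] by (simp add: normalized_trace_def)
  qed
  moreover have "(\<integral>\<omega>. (\<Sum>a<d. path_sum d w (F \<omega>) a a) / of_nat d \<partial>\<Omega>)
      = (\<Sum>a<d. path_sum d w (wexp (gue_cov d)) a a) / of_nat d"
    using integral_path_sum[of \<Omega> F, OF int] by (simp add: integral_sum EF)
  ultimately show ?thesis
    by (simp add: gue_distribution_def nc_monom_def lin_ext_single wcoeff_trace_wfun)
qed

end

section \<open>The limit theorem\<close>

theorem theorem1p7:
  fixes d :: nat
    and \<gamma> :: "'r::finite \<Rightarrow> nat \<Rightarrow> (sinf \<Rightarrow>\<^sub>0 complex)"
    and s :: "'r \<Rightarrow> nat \<Rightarrow> (sinf \<Rightarrow>\<^sub>0 complex)"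
  assumes d: "d \<ge> 1"
    and \<gamma>_range: "\<And>p n. n \<ge> 1 \<Longrightarrow> \<gamma> p n \<in> star_generator ` {1..}"
    and \<gamma>_inj: "inj_on (\<lambda>(p, n). \<gamma> p n) (UNIV \<times> {1..})"
    and s: "\<And>p n. n \<ge> 1 \<Longrightarrow>
      s p n = scalar (1 / complex_of_real (sqrt (real n))) *
        ((\<Sum>k=1..n. \<gamma> p k) - scalar (of_nat n / of_nat d))"
  shows "\<exists>\<mu> \<in> states.
    (\<forall>P. (\<lambda>n. joint_distribution (phi d) (\<lambda>p. s p n) P) \<longlonglongrightarrow> \<mu> P) \<and>
    (\<forall>(\<Omega> :: 'w measure) \<xi> \<eta>. gue_entries d \<Omega> \<xi> \<eta> \<longrightarrow>
      comm_egf \<mu> * mfps_exp (mfps_const (1 / (2 * of_nat d ^ 2)) * (\<Sum>p\<in>UNIV. mfps_var p ^ 2))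
        = comm_egf (gue_distribution d \<Omega> \<xi> \<eta>))"
proof -
  let ?K = "\<Prod>p\<in>(UNIV :: 'r set). site_trace d p"
  let ?E = "pair_wfun (1 / of_nat d ^ 2) :: 'r wfun"
  \<comment> \<open>The candidate limit: word moments of matrices whose entries are Gaussian with
    the two-letter part of \<open>?K\<close> as covariance.\<close>
  define m where "m = trace_wfun d (wexp (whomog 2 ?K))"
  define \<mu> where "\<mu> = lin_ext (\<lambda>w. wcoeff m (letters w))"
  have \<mu>_monom: "\<mu> (nc_monom w) = wcoeff m w" for w
    by (simp add: \<mu>_def nc_monom_def lin_ext_single)

  have "\<forall>x\<in>UNIV \<times> {1..}. \<exists>k\<ge>1. (\<lambda>(p, n). \<gamma> p n) x = star_generator k"
    using \<gamma>_range by fastforce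
  then obtain ix where ix: "\<And>p n. n \<ge> 1 \<Longrightarrow> ix (p, n) \<ge> 1 \<and> \<gamma> p n = star_generator (ix (p, n))"
    by (metis (no_types, lifting) SigmaI UNIV_I atLeast_iff case_prod_conv)
  have ix_inj: "inj_on ix (UNIV \<times> {1..})"
  proof (rule inj_onI)
    fix x y assume xy: "x \<in> UNIV \<times> {1..}" "y \<in> UNIV \<times> {1..}" "ix x = ix y"
    obtain p n q k where x: "x = (p, n)" and y: "y = (q, k)" by (cases x, cases y)
    then have "n \<ge> 1" "k \<ge> 1" using xy by auto
    then have "\<gamma> p n = \<gamma> q k" using ix[of n p] ix[of k q] xy x y by simp
    then show "x = y" using inj_onD[OF \<gamma>_inj, of x y] xy x y by simp
  qed
  \<comment> \<open>The star-generator with index \<open>k\<close> exchanges 1 and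
    \<open>k + 1\<close>, so its site is the successor of its index, and \<open>t\<close> subtracts
    one again.\<close>
  define site_of where "site_of x = Suc (ix x)" for x
  define lab where "lab u = fst (inv_into (UNIV \<times> {1..}) site_of u)" for u
  define t where "t u = star_transposition (u - 1)" for u
  have site_inj: "inj_on site_of (UNIV \<times> {1..})"
    using ix_inj by (auto simp: site_of_def inj_on_def)
  have lab: "lab (site_of (p, n)) = p" if "n \<ge> 1" for p n
    using inv_into_f_f[OF site_inj, of "(p, n)"] that by (simp add: lab_def del: One_nat_def)

  have word: "joint_distribution (phi d) (\<lambda>p. s p n) (nc_monom w)
      = (\<Sum>a<d. path_sum d w (wdil (1 / complex_of_real (sqrt (real n))) ?K ^ n) a a) / of_nat d"
    if n: "n \<ge> 1" for n w
  proof -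
    let ?c = "1 / complex_of_real (sqrt (real n))"
    let ?V = "site_of ` (UNIV \<times> {1..n})"
    have sub: "UNIV \<times> {1..n} \<subseteq> UNIV \<times> {1::nat..}" by auto
    interpret site_labelling ?V lab t d
    proof
      fix u assume "u \<in> ?V"
      then obtain p k where u: "u = site_of (p, k)" "k \<ge> 1" by auto
      then show "u \<ge> 2" using ix[of k p] by (simp add: site_of_def)
      then show "sinf_apply (t u) = Transposition.transpose 1 u"
        by (simp add: t_def star_transposition.rep_eq)
    qed (use d in auto)
    \<comment> \<open>Injectivity of \<open>\<gamma>\<close> gives the label \<open>p\<close>
      exactly \<open>n\<close> distinct sites, over which the constant \<open>n / d\<close> is
      distributed.\<close>
    have jump: "(\<Sum>k=1..n. \<gamma> p k) - scalar (of_nat n / of_nat d) = jump p" for p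
    proof -
      have "{u\<in>?V. lab u = p} = (\<lambda>k. site_of (p, k)) ` {1..n}" by (auto simp: lab)
      moreover have "inj_on (\<lambda>k. site_of (p, k)) {1..n}"
      proof (rule inj_onI)
        fix k l assume "k \<in> {1..n}" "l \<in> {1..n}" "site_of (p, k) = site_of (p, l)"
        then show "k = l" using inj_onD[OF site_inj, of "(p, k)" "(p, l)"] by simp
      qed
      ultimately have "jump p = (\<Sum>k=1..n. Poly_Mapping.single (t (site_of (p, k))) 1 - scalar (1 / of_nat d))"
        unfolding jump_def by (simp add: sum.reindex)
      also have "\<dots> = (\<Sum>k=1..n. \<gamma> p k - scalar (1 / of_nat d))"
        by (rule sum.cong) (use ix in \<open>auto simp: t_def site_of_def star_generator_def\<close>)
      also have "\<dots> = (\<Sum>k=1..n. \<gamma> p k) - scalar (of_nat n / of_nat d)"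
        unfolding sum_subtractf
        by (rule arg_cong2[where f = minus, OF refl], rule poly_mapping_eqI)
          (simp only: lookup_sum, simp add: scalar_def lookup_single when_def)
      finally show ?thesis by simp
    qed
    have "prod_list (map (\<lambda>p. s p n) w) = scalar (?c ^ length w) * prod_list (map jump w)"
    proof (induction w)
      case Nil
      then show ?case by (simp add: scalar_1)
    next
      case (Cons p w)
      have "prod_list (map (\<lambda>p. s p n) (p # w)) = scalar ?c * (jump p * scalar (?c ^ length w)) * prod_list (map jump w)"
        unfolding list.map prod_list.Cons Cons.IH by (simp only: s[OF n] jump mult.assoc)
      also have "\<dots> = (scalar ?c * scalar (?c ^ length w)) * (jump p * prod_list (map jump w))"
        by (subst scalar_commute[of "?c ^ length w" "jump p", symmetric]) (simp only: mult.assoc)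
      finally show ?case by (simp add: scalar_mult_scalar)
    qed
    then have "phi d (prod_list (map (\<lambda>p. s p n) w)) = ?c ^ length w * phi d (prod_list (map jump w))"
      by (simp only: phi_def lin_ext_scalar)
    \<comment> \<open>Each label owns \<open>n\<close> sites with the same trace, so the product
      over all sites is an \<open>n\<close>-th power, the form required by the central limit
      theorem.\<close>
    moreover have "(\<Prod>u\<in>?V. site_trace d (lab u)) = ?K ^ n"
    proof -
      have "(\<Prod>u\<in>?V. site_trace d (lab u)) = (\<Prod>(p, k)\<in>UNIV \<times> {1..n}. site_trace d p)"
        by (subst prod.reindex[OF inj_on_subset[OF site_inj sub]]) (auto simp: lab intro!: prod.cong)
      then show ?thesis by (simp add: prod.cartesian_product[symmetric] prod_power_distrib)
    qed
    ultimately show ?thesis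
      by (simp only: joint_distribution_nc_monom phi_word wdil_power[symmetric] path_sum_wdil
          sum_distrib_left times_divide_eq_right)
  qed

  have lim_word: "(\<lambda>n. joint_distribution (phi d) (\<lambda>p. s p n) (nc_monom w)) \<longlonglongrightarrow> wcoeff m w" for w
  proof (rule Lim_transform_eventually)
    show "(\<lambda>n. (\<Sum>a<d. path_sum d w (wdil (1 / complex_of_real (sqrt (real n))) ?K ^ n) a a) / of_nat d) \<longlonglongrightarrow> wcoeff m w"
      unfolding m_def wcoeff_trace_wfun
    proof (intro tendsto_divide tendsto_sum tendsto_path_sum tendsto_const)
      fix v
      have "wcoeff ?K [] = 1" using d by (simp add: wcoeff_prod_Nil wcoeff_site_trace_Nil)
      moreover have "wcoeff ?K [x] = 0" for x
        using d by (intro wcoeff_prod_singleton) (simp_all add: wcoeff_site_trace_Nil wcoeff_site_trace_singleton)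
      ultimately show "(\<lambda>n. wcoeff (wdil (1 / complex_of_real (sqrt (real n))) ?K ^ n) v) \<longlonglongrightarrow> wcoeff (wexp (whomog 2 ?K)) v"
        using central_limit_wfun[of ?K 0 v] by simp
    qed (use d in simp)
    show "\<forall>\<^sub>F n in sequentially. (\<Sum>a<d. path_sum d w (wdil (1 / complex_of_real (sqrt (real n))) ?K ^ n) a a) / of_nat d
        = joint_distribution (phi d) (\<lambda>p. s p n) (nc_monom w)"
      using eventually_ge_at_top[of 1] by eventually_elim (simp add: word)
  qed
  have lim: "(\<lambda>n. joint_distribution (phi d) (\<lambda>p. s p n) P) \<longlonglongrightarrow> \<mu> P" for P
    unfolding joint_distribution_def \<mu>_def lin_ext_def
    by (intro tendsto_sum tendsto_mult tendsto_const) (simp only: lim_word[unfolded joint_distribution_nc_monom])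

  have star: "star (s p n) = s p n" if "n \<ge> 1" for p n
  proof -
    have "star (\<gamma> p k) = \<gamma> p k" if "k \<ge> 1" for k
      using \<gamma>_range[OF that, of p] star_star_generator by auto
    then show ?thesis
      unfolding s[OF that] by (simp add: star_mult star_diff star_sum scalar_commute)
  qed
  have "\<forall>\<^sub>F n in sequentially. joint_distribution (phi d) (\<lambda>p. s p n) \<in> states"
    using eventually_ge_at_top[of 1]
  proof eventually_elim
    case (elim n)
    show ?case by (rule joint_distribution_in_states[OF phi_in_states[OF d] star[OF elim]])
  qed
  then have "\<mu> \<in> states" by (rule limit_in_states) (rule lim)
  moreover have "comm_egf \<mu> * mfps_exp (mfps_const (1 / (2 * of_nat d ^ 2)) * (\<Sum>p\<in>UNIV. mfps_var p ^ 2))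
        = comm_egf (gue_distribution d \<Omega> \<xi> \<eta>)" if gue: "gue_entries d \<Omega> \<xi> \<eta>"
    for \<Omega> :: "'w measure" and \<xi> \<eta> :: "'r \<Rightarrow> nat \<Rightarrow> nat \<Rightarrow> 'w \<Rightarrow> real"
  proof -
    have E0: "wcoeff ?E [] = 0" by (simp add: pair_wfun_def)
    \<comment> \<open>The covariance is a sum, so its exponential is a product; the second factor is
      a lifted scalar exponential, which can be taken out of the trace.\<close>
    have "wexp (gue_cov d) = wexp (whomog 2 ?K) * diag_lift d (wexp ?E)"
      unfolding gue_cov_decomposition[OF d]
      by (subst wexp_add) (simp_all add: wexp_diag_lift E0 whomog_def)
    then have "comm_egf (gue_distribution d \<Omega> \<xi> \<eta>) = wegf (m * wexp ?E)"
      by (simp add: comm_egf_def wegf_def gue_distribution_eq_trace_wexp[OF d gue] m_def trace_wfun_mult_diag_lift)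
    also have "\<dots> = wegf m * mfps_exp (mfps_const (1 / of_nat d ^ 2 / 2) * (\<Sum>p\<in>UNIV. mfps_var p ^ 2))"
      by (simp only: wegf_mult wegf_wexp[OF E0] wegf_pair_wfun)
    also have "wegf m = comm_egf \<mu>"
      by (simp add: comm_egf_def wegf_def \<mu>_monom)
    finally show ?thesis by (simp add: mult.commute)
  qed
  ultimately show ?thesis using lim by blast
qed

end
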